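(* Let $(M^{4n},Q,\omega)$, $n>1$, be an almost quaternionic skew-Hermitian manifold and let $(N^{2k},\hat J,\hat\omega,\hat g)$ be an almost pseudo-Hermitian submanifold of $M$. Then: (1) If $(M^{4n},Q,\omega)$ is of type $\mathcal X_{15}$, i.e. $d\omega=0$, then $(N^{2k},\hat J,\hat\omega,\hat g)$ is almost pseudo-Kähler. (2) If $(M^{4n},Q,\omega)$ is either torsion-free or of type $\mathcal X_5$ (i.e. $d\omega=0$ and $Q$ is quaternionic), then $(N^{2k},\hat J,\hat\omega,\hat g)$ is pseudo-Kähler if and only if the local 1-form $\psi=\gamma_3\circ J_1-\gamma_2$ vanishes on $TN$.
   Context: An almost quaternionic structure on $M^{4n}$ ($n>1$) is a rank-3 subbundle $Q\subset\mathrm{End}(TM)$ locally spanned by an admissible basis $J_1,J_2,J_3$, i.e. $J_a^2=-\mathrm{Id}$, $J_1J_2=J_3=-J_2J_1$. An almost quaternionic skew-Hermitian (qs-H) manifold $(M^{4n},Q,\omega)$ is such a manifold with a non-degenerate 2-form $\omega$ satisfying $\omega(J_aX,J_aY)=\omega(X,Y)$ for every admissible basis. Adapted connection. $N_J(X,Y)=[JX,JY]-J[JX,Y]-J[X,JY]-[X,Y]$. The Obata connection $\nabla^H$ of an admissible basis $H=\{J_a\}$ is the unique connection with $\nabla^HJ_a=0$ and torsion $T^H=\frac16\sum_aN_{J_a}$. With $\mathrm{vol}=\omega^{2n}$, the unimodular Oproiu connection $\nabla^{Q,\mathrm{vol}}$ is the unique connection preserving $Q$ and $\mathrm{vol}$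 whose torsion is, for any admissible basis, $T^Q=T^H+\sum_a\partial(\tau_a\otimes J_a)$, where $\tau_a(X)=\frac1{4n-2}\mathrm{tr}(J_aT^H_X)$ and $\partial(\tau\otimes J)(X,Y)=\tau(X)JY-\tau(Y)JX$. Then $\nabla^{Q,\omega}=\nabla^{Q,\mathrm{vol}}+A$ with $\omega(A(X,Y),Z)=\frac12(\nabla^{Q,\mathrm{vol}}_X\omega)(Y,Z)$; it preserves $Q$ and $\omega$, and $T^{Q,\omega}$ is its torsion. Torsion-free means $T^{Q,\omega}=0$; $Q$ is quaternionic iff $T^Q=0$. Given an admissible basis, local 1-forms $\gamma_a$ are defined by $\nabla^{Q,\omega}_XJ_a=\gamma_c(X)J_b-\gamma_b(X)J_c$ for every cyclic permutation $(a,b,c)$ of $(1,2,3)$. An almost complex submanifold $(N^{2k},\hat J)$ of $(M,Q,\omega)$ is a submanifold $\iota:N\to M$ with an almost complex structure $\hat J$ that is the restriction to $TN$ of a section of $Q$ along $N$. An adapted basis is a (local) admissible basis with $J_1|_{TN}=\hat J$; one is fixed in defining $\psi$. An almost pseudo-Hermitian submanifold $(N^{2k},\hat J,\hat\omega,\hat g)$ is an almost complex submanifold for which $\hat\omega=\iota^*\omega$ is non-degenerate, with $\hat g(X,Y)=\hat\omega(X,\hat JY)$; then $(\hat g,\hat J)$ is almost pseudo-Hermitian. It is almost pseudo-Kähler if $d\hat\omega=0$, and pseudo-Kähler if moreover $\hat J$ is integrable.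
   Formalization: In (2), "pseudo-Kähler implies ψ = 0 on TN" is stated only for k > 1, since it fails for k = 1 (surfaces are always pseudo-Kähler, but ψ can be nonzero, e.g. on a cylinder in flat H^n); the converse and part (1) hold for all k. *)

theory Defs
  imports "HOL-Analysis.Analysis"
begin

text \<open>
  \<open>Ck_on k S f\<close> is meant for open \<open>S\<close> in a finite-dimensional domain, where continuity of
  all iterated directional derivatives up to order \<open>k\<close> is the usual \<open>C\<^sup>k\<close> condition.
\<close>

primrec Ck_on :: "nat \<Rightarrow> 'a::real_normed_vector set \<Rightarrow> ('a \<Rightarrow> 'b::real_normed_vector) \<Rightarrow> bool" where
  "Ck_on 0 = (\<lambda>S f. continuous_on S f)"
| "Ck_on (Suc k) = (\<lambda>S f. (\<forall>x\<in>S. f differentiable (at x)) \<and>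
      (\<forall>v. Ck_on k S (\<lambda>x. frechet_derivative f (at x) v)))"

definition smooth_on :: "'a::real_normed_vector set \<Rightarrow> ('a \<Rightarrow> 'b::real_normed_vector) \<Rightarrow> bool" where
  "smooth_on S f \<longleftrightarrow> (\<forall>k. Ck_on k S f)"

type_synonym ('m, 'e) chart = "'m set \<times> ('m \<Rightarrow> 'e)"
type_synonym ('m, 'e) atlas = "('m, 'e) chart set"

abbreviation cdom :: "('m, 'e) chart \<Rightarrow> 'm set" where "cdom c \<equiv> fst c"
abbreviation cmap :: "('m, 'e) chart \<Rightarrow> 'm \<Rightarrow> 'e" where "cmap c \<equiv> snd c"

definition cinv :: "('m, 'e) chart \<Rightarrow> 'e \<Rightarrow> 'm" where
  "cinv c = inv_into (cdom c) (cmap c)"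

text \<open>
  The underlying space of a manifold is the whole type \<open>'m\<close>; the Hausdorff and
  second-countability axioms are type-class constraints on \<open>'m\<close>.
\<close>

definition smooth_atlas :: "('m::topological_space, 'e::euclidean_space) atlas \<Rightarrow> bool" where
  "smooth_atlas A \<longleftrightarrow>
     (\<forall>c\<in>A. open (cdom c) \<and> open (cmap c ` cdom c) \<and>
        homeomorphism (cdom c) (cmap c ` cdom c) (cmap c) (cinv c)) \<and>
     (\<Union>c\<in>A. cdom c) = UNIV \<and>
     (\<forall>c\<in>A. \<forall>c'\<in>A. smooth_on (cmap c ` (cdom c \<inter> cdom c')) (cmap c' \<circ> cinv c))"

text \<open>
  For each point \<open>p\<close> one chart around \<open>p\<close> is chosen once and for all, and \<open>T\<^sub>pM\<close> is identified
  with the model space \<open>'e\<close> by means of that chart.  Hence a vector field is a map \<open>'m \<Rightarrow> 'e\<close>,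
  a field of endomorphisms of \<open>TM\<close> a map \<open>'m \<Rightarrow> 'e \<Rightarrow> 'e\<close>, and so on.  As the chosen chart jumps
  from point to point, smoothness is not smoothness of these maps: it is expressed through
  the components with respect to each chart of the atlas.
\<close>

definition chart_at :: "('m, 'e) atlas \<Rightarrow> 'm \<Rightarrow> ('m, 'e) chart" where
  "chart_at A p = (SOME c. c \<in> A \<and> p \<in> cdom c)"

text \<open>
  \<open>tcoord A c p\<close> sends a vector in \<open>T\<^sub>pM\<close> to its components in the chart \<open>c\<close>, and
  \<open>coord_field A c w\<close> is the vector field on \<open>cdom c\<close> with constant components \<open>w\<close> in \<open>c\<close>.
\<close>

definition tcoord :: "('m, 'e::euclidean_space) atlas \<Rightarrow> ('m, 'e) chart \<Rightarrow> 'm \<Rightarrow> 'e \<Rightarrow> 'e" where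
  "tcoord A c p v =
     frechet_derivative (cmap c \<circ> cinv (chart_at A p)) (at (cmap (chart_at A p) p)) v"

definition coord_field :: "('m, 'e::euclidean_space) atlas \<Rightarrow> ('m, 'e) chart \<Rightarrow> 'e \<Rightarrow> 'm \<Rightarrow> 'e" where
  "coord_field A c w q =
     frechet_derivative (cmap (chart_at A q) \<circ> cinv c) (at (cmap c q)) w"

text \<open>
  A local vector field with value \<open>v\<close> at \<open>p\<close>; it is used to evaluate tensorial expressions
  on tangent vectors.
\<close>

definition ext :: "('m, 'e::euclidean_space) atlas \<Rightarrow> 'm \<Rightarrow> 'e \<Rightarrow> 'm \<Rightarrow> 'e" where
  "ext A p v = coord_field A (chart_at A p) v"

definition dfun :: "('m, 'e::euclidean_space) atlas \<Rightarrow> ('m \<Rightarrow> real) \<Rightarrow> 'm \<Rightarrow> 'e \<Rightarrow> real" where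
  "dfun A f p v =
     frechet_derivative (f \<circ> cinv (chart_at A p)) (at (cmap (chart_at A p) p)) v"

definition tmap :: "('m, 'e::euclidean_space) atlas \<Rightarrow> ('n, 'f::euclidean_space) atlas \<Rightarrow>
    ('n \<Rightarrow> 'm) \<Rightarrow> 'n \<Rightarrow> 'f \<Rightarrow> 'e" where
  "tmap A B \<iota> x v =
     frechet_derivative (cmap (chart_at A (\<iota> x)) \<circ> \<iota> \<circ> cinv (chart_at B x))
       (at (cmap (chart_at B x) x)) v"

definition smooth_map :: "('m::topological_space, 'e::euclidean_space) atlas \<Rightarrow>
    ('n::topological_space, 'f::euclidean_space) atlas \<Rightarrow> ('n \<Rightarrow> 'm) \<Rightarrow> bool" where
  "smooth_map A B \<iota> \<longleftrightarrow> continuous_on UNIV \<iota> \<and>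
     (\<forall>c\<in>A. \<forall>b\<in>B. smooth_on (cmap b ` (cdom b \<inter> \<iota> -` cdom c)) (cmap c \<circ> \<iota> \<circ> cinv b))"

definition smooth_fun :: "('m, 'e::euclidean_space) atlas \<Rightarrow> 'm set \<Rightarrow>
    ('m \<Rightarrow> 'b::real_normed_vector) \<Rightarrow> bool" where
  "smooth_fun A U f \<longleftrightarrow> (\<forall>c\<in>A. smooth_on (cmap c ` (U \<inter> cdom c)) (f \<circ> cinv c))"

definition field_rep :: "('m, 'e::euclidean_space) atlas \<Rightarrow> ('m, 'e) chart \<Rightarrow> ('m \<Rightarrow> 'e) \<Rightarrow> 'e \<Rightarrow> 'e" where
  "field_rep A c X = (\<lambda>u. tcoord A c (cinv c u) (X (cinv c u)))"

definition smooth_field :: "('m, 'e::euclidean_space) atlas \<Rightarrow> 'm set \<Rightarrow> ('m \<Rightarrow> 'e) \<Rightarrow> bool" where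
  "smooth_field A U X \<longleftrightarrow> (\<forall>c\<in>A. smooth_on (cmap c ` (U \<inter> cdom c)) (field_rep A c X))"

definition smooth_End :: "('m, 'e::euclidean_space) atlas \<Rightarrow> 'm set \<Rightarrow> ('m \<Rightarrow> 'e \<Rightarrow> 'e) \<Rightarrow> bool" where
  "smooth_End A U J \<longleftrightarrow> (\<forall>p\<in>U. linear (J p)) \<and>
     (\<forall>c\<in>A. \<forall>w. smooth_field A (U \<inter> cdom c) (\<lambda>q. J q (coord_field A c w q)))"

definition two_form :: "('m, 'e::euclidean_space) atlas \<Rightarrow> ('m \<Rightarrow> 'e \<Rightarrow> 'e \<Rightarrow> real) \<Rightarrow> bool" where
  "two_form A \<omega> \<longleftrightarrow> (\<forall>p. bilinear (\<omega> p) \<and> (\<forall>u v. \<omega> p u v = - \<omega> p v u)) \<and>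
     (\<forall>c\<in>A. \<forall>v w. smooth_fun A (cdom c) (\<lambda>q. \<omega> q (coord_field A c v q) (coord_field A c w q)))"

definition nondegenerate :: "('m \<Rightarrow> 'e::euclidean_space \<Rightarrow> 'e \<Rightarrow> real) \<Rightarrow> bool" where
  "nondegenerate \<omega> \<longleftrightarrow> (\<forall>p u. (\<forall>v. \<omega> p u v = 0) \<longrightarrow> u = 0)"

text \<open>The Lie bracket is \<open>D Y X - D X Y\<close> in the coordinates of the chosen chart at \<open>p\<close>.\<close>

definition lie_bracket :: "('m, 'e::euclidean_space) atlas \<Rightarrow> ('m \<Rightarrow> 'e) \<Rightarrow> ('m \<Rightarrow> 'e) \<Rightarrow> 'm \<Rightarrow> 'e" where
  "lie_bracket A X Y p = (let c = chart_at A p in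
     frechet_derivative (field_rep A c Y) (at (cmap c p)) (X p) -
     frechet_derivative (field_rep A c X) (at (cmap c p)) (Y p))"

text \<open>
  The exterior derivative
  \<open>d\<omega>(u,v,w) = \<partial>\<^sub>u \<omega>(v,w) + \<partial>\<^sub>v \<omega>(w,u) + \<partial>\<^sub>w \<omega>(u,v)\<close>, computed with (commuting) coordinate fields.
\<close>

definition ext_deriv :: "('m, 'e::euclidean_space) atlas \<Rightarrow> ('m \<Rightarrow> 'e \<Rightarrow> 'e \<Rightarrow> real) \<Rightarrow>
    'm \<Rightarrow> 'e \<Rightarrow> 'e \<Rightarrow> 'e \<Rightarrow> real" where
  "ext_deriv A \<omega> p u v w =
     dfun A (\<lambda>q. \<omega> q (ext A p v q) (ext A p w q)) p u +
     dfun A (\<lambda>q. \<omega> q (ext A p w q) (ext A p u q)) p v +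
     dfun A (\<lambda>q. \<omega> q (ext A p u q) (ext A p v q)) p w"

definition closed_form :: "('m, 'e::euclidean_space) atlas \<Rightarrow> ('m \<Rightarrow> 'e \<Rightarrow> 'e \<Rightarrow> real) \<Rightarrow> bool" where
  "closed_form A \<omega> \<longleftrightarrow> (\<forall>p u v w. ext_deriv A \<omega> p u v w = 0)"

definition nijenhuis :: "('m, 'e::euclidean_space) atlas \<Rightarrow> ('m \<Rightarrow> 'e \<Rightarrow> 'e) \<Rightarrow>
    ('m \<Rightarrow> 'e) \<Rightarrow> ('m \<Rightarrow> 'e) \<Rightarrow> 'm \<Rightarrow> 'e" where
  "nijenhuis A J X Y p =
     lie_bracket A (\<lambda>q. J q (X q)) (\<lambda>q. J q (Y q)) p
     - J p (lie_bracket A (\<lambda>q. J q (X q)) Y p)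
     - J p (lie_bracket A X (\<lambda>q. J q (Y q)) p)
     - lie_bracket A X Y p"

definition almost_complex :: "('m, 'e::euclidean_space) atlas \<Rightarrow> ('m \<Rightarrow> 'e \<Rightarrow> 'e) \<Rightarrow> bool" where
  "almost_complex A J \<longleftrightarrow> smooth_End A UNIV J \<and> (\<forall>p v. J p (J p v) = - v)"

text \<open>Integrability of an almost complex structure is vanishing of its Nijenhuis tensor.\<close>

definition integrable_acs :: "('m::topological_space, 'e::euclidean_space) atlas \<Rightarrow>
    ('m \<Rightarrow> 'e \<Rightarrow> 'e) \<Rightarrow> bool" where
  "integrable_acs A J \<longleftrightarrow> (\<forall>U X Y. open U \<and> smooth_field A U X \<and> smooth_field A U Y \<longrightarrow>
     (\<forall>p\<in>U. nijenhuis A J X Y p = 0))"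

text \<open>
  A connection on the open set \<open>S\<close> is given as an operator on local vector fields, compatible
  with restriction to smaller open sets; \<open>D Y p v\<close> stands for \<open>\<nabla>\<^sub>v Y\<close> with \<open>v \<in> T\<^sub>pM\<close>.
\<close>

type_synonym ('m, 'e) conn = "('m \<Rightarrow> 'e) \<Rightarrow> 'm \<Rightarrow> 'e \<Rightarrow> 'e"

definition connection_on :: "('m::topological_space, 'e::euclidean_space) atlas \<Rightarrow> 'm set \<Rightarrow>
    ('m, 'e) conn \<Rightarrow> bool" where
  "connection_on A S D \<longleftrightarrow>
    (\<forall>U X Y. open U \<and> U \<subseteq> S \<and> smooth_field A U X \<and> smooth_field A U Y \<longrightarrow>
       (\<forall>p\<in>U. linear (D Y p)) \<and>
       ((\<forall>q\<in>U. X q = Y q) \<longrightarrow> (\<forall>p\<in>U. D X p = D Y p)) \<and>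
       (\<forall>p\<in>U. \<forall>v. D (\<lambda>q. X q + Y q) p v = D X p v + D Y p v) \<and>
       (\<forall>f. smooth_fun A U f \<longrightarrow>
          (\<forall>p\<in>U. \<forall>v. D (\<lambda>q. f q *\<^sub>R Y q) p v = dfun A f p v *\<^sub>R Y p + f p *\<^sub>R D Y p v)) \<and>
       smooth_field A U (\<lambda>q. D Y q (X q)))"

definition torsion :: "('m, 'e::euclidean_space) atlas \<Rightarrow> ('m, 'e) conn \<Rightarrow>
    ('m \<Rightarrow> 'e) \<Rightarrow> ('m \<Rightarrow> 'e) \<Rightarrow> 'm \<Rightarrow> 'e" where
  "torsion A D X Y p = D Y p (X p) - D X p (Y p) - lie_bracket A X Y p"

definition torsion_free :: "('m::topological_space, 'e::euclidean_space) atlas \<Rightarrow> ('m, 'e) conn \<Rightarrow> bool" where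
  "torsion_free A D \<longleftrightarrow> (\<forall>U X Y. open U \<and> smooth_field A U X \<and> smooth_field A U Y \<longrightarrow>
     (\<forall>p\<in>U. torsion A D X Y p = 0))"

text \<open>
  Induced covariant derivatives of an endomorphism field, \<open>(\<nabla>\<^sub>u J) v\<close>, and of a 2-form,
  \<open>(\<nabla>\<^sub>u \<omega>)(v,w)\<close>, at \<open>p\<close>.
\<close>

definition cov_End :: "('m, 'e::euclidean_space) atlas \<Rightarrow> ('m, 'e) conn \<Rightarrow> ('m \<Rightarrow> 'e \<Rightarrow> 'e) \<Rightarrow>
    'm \<Rightarrow> 'e \<Rightarrow> 'e \<Rightarrow> 'e" where
  "cov_End A D J p u v = D (\<lambda>q. J q (ext A p v q)) p u - J p (D (ext A p v) p u)"

definition cov_form :: "('m, 'e::euclidean_space) atlas \<Rightarrow> ('m, 'e) conn \<Rightarrow>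
    ('m \<Rightarrow> 'e \<Rightarrow> 'e \<Rightarrow> real) \<Rightarrow> 'm \<Rightarrow> 'e \<Rightarrow> 'e \<Rightarrow> 'e \<Rightarrow> real" where
  "cov_form A D \<omega> p u v w =
     dfun A (\<lambda>q. \<omega> q (ext A p v q) (ext A p w q)) p u
     - \<omega> p (D (ext A p v) p u) w - \<omega> p v (D (ext A p w) p u)"

text \<open>
  A local frame \<open>(J\<^sub>1,J\<^sub>2,J\<^sub>3)\<close> is a function on \<open>nat\<close> of which only the values at 1, 2, 3 matter.
\<close>

definition admissible_basis :: "('m::topological_space, 'e::euclidean_space) atlas \<Rightarrow>
    ('m \<Rightarrow> ('e \<Rightarrow> 'e) set) \<Rightarrow> 'm set \<Rightarrow> (nat \<Rightarrow> 'm \<Rightarrow> 'e \<Rightarrow> 'e) \<Rightarrow> bool" where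
  "admissible_basis A Q U J \<longleftrightarrow> open U \<and>
     (\<forall>a\<in>{1,2,3}. smooth_End A U (J a) \<and> (\<forall>p\<in>U. \<forall>v. J a p (J a p v) = - v)) \<and>
     (\<forall>p\<in>U. \<forall>v. J 1 p (J 2 p v) = J 3 p v \<and> J 2 p (J 1 p v) = - J 3 p v) \<and>
     (\<forall>p\<in>U. Q p = {(\<lambda>v. r *\<^sub>R J 1 p v + s *\<^sub>R J 2 p v + t *\<^sub>R J 3 p v) | r s t. True})"

definition almost_quaternionic :: "('m::topological_space, 'e::euclidean_space) atlas \<Rightarrow>
    ('m \<Rightarrow> ('e \<Rightarrow> 'e) set) \<Rightarrow> bool" where
  "almost_quaternionic A Q \<longleftrightarrow> (\<forall>p. \<exists>U J. p \<in> U \<and> admissible_basis A Q U J)"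

definition almost_qsH :: "nat \<Rightarrow> ('m::{t2_space,second_countable_topology}, 'e::euclidean_space) atlas \<Rightarrow>
    ('m \<Rightarrow> ('e \<Rightarrow> 'e) set) \<Rightarrow> ('m \<Rightarrow> 'e \<Rightarrow> 'e \<Rightarrow> real) \<Rightarrow> bool" where
  "almost_qsH n A Q \<omega> \<longleftrightarrow>
     1 < n \<and> DIM('e) = 4 * n \<and> smooth_atlas A \<and> almost_quaternionic A Q \<and>
     two_form A \<omega> \<and> nondegenerate \<omega> \<and>
     (\<forall>U J. admissible_basis A Q U J \<longrightarrow>
        (\<forall>a\<in>{1,2,3}. \<forall>p\<in>U. \<forall>u v. \<omega> p (J a p u) (J a p v) = \<omega> p u v))"

definition obata_connection :: "('m::topological_space, 'e::euclidean_space) atlas \<Rightarrow> 'm set \<Rightarrow>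
    (nat \<Rightarrow> 'm \<Rightarrow> 'e \<Rightarrow> 'e) \<Rightarrow> ('m, 'e) conn \<Rightarrow> bool" where
  "obata_connection A U J D \<longleftrightarrow> connection_on A U D \<and>
     (\<forall>a\<in>{1,2,3}. \<forall>p\<in>U. \<forall>u v. cov_End A D (J a) p u v = 0) \<and>
     (\<forall>W X Y. open W \<and> W \<subseteq> U \<and> smooth_field A W X \<and> smooth_field A W Y \<longrightarrow>
        (\<forall>p\<in>W. torsion A D X Y p = (1/6) *\<^sub>R (\<Sum>a\<in>{1,2,3}. nijenhuis A (J a) X Y p)))"

definition trace_End :: "('e::euclidean_space \<Rightarrow> 'e) \<Rightarrow> real" where
  "trace_End f = (\<Sum>b\<in>Basis. f b \<bullet> b)"

text \<open>\<open>\<tau>\<^sub>a(u) = tr(J\<^sub>a T\<^sub>u) / (4n - 2)\<close>, where \<open>T\<close> is the torsion of \<open>D\<close>.\<close>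

definition tau :: "nat \<Rightarrow> ('m, 'e::euclidean_space) atlas \<Rightarrow> ('m, 'e) conn \<Rightarrow>
    ('m \<Rightarrow> 'e \<Rightarrow> 'e) \<Rightarrow> 'm \<Rightarrow> 'e \<Rightarrow> real" where
  "tau n A D Ja p u =
     trace_End (\<lambda>v. Ja p (torsion A D (ext A p u) (ext A p v) p)) / (4 * real n - 2)"

text \<open>
  The \<open>4n\<close>-form \<open>\<omega> \<and> \<dots> \<and> \<omega>\<close> (\<open>2n\<close> factors), with the convention
  \<open>\<alpha> \<and> \<beta> = Alt-sum(\<alpha> \<otimes> \<beta>) / (p! q!)\<close>; its arguments are \<open>v 0, \<dots>, v (4n - 1)\<close>.
\<close>

definition vol_form :: "nat \<Rightarrow> ('m \<Rightarrow> 'e \<Rightarrow> 'e \<Rightarrow> real) \<Rightarrow> 'm \<Rightarrow> (nat \<Rightarrow> 'e) \<Rightarrow> real" where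
  "vol_form n \<omega> p v = (1 / 2 ^ (2 * n)) *
     (\<Sum>\<sigma> | \<sigma> permutes {..<4 * n}. of_int (sign \<sigma>) *
        (\<Prod>i<2 * n. \<omega> p (v (\<sigma> (2 * i))) (v (\<sigma> (2 * i + 1)))))"

definition preserves_vol :: "nat \<Rightarrow> ('m, 'e::euclidean_space) atlas \<Rightarrow>
    ('m \<Rightarrow> 'e \<Rightarrow> 'e \<Rightarrow> real) \<Rightarrow> ('m, 'e) conn \<Rightarrow> bool" where
  "preserves_vol n A \<omega> D \<longleftrightarrow> (\<forall>p u v.
     dfun A (\<lambda>q. vol_form n \<omega> q (\<lambda>i. ext A p (v i) q)) p u
     - (\<Sum>i<4 * n. vol_form n \<omega> p (v(i := D (ext A p (v i)) p u))) = 0)"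

definition preserves_Q :: "('m::topological_space, 'e::euclidean_space) atlas \<Rightarrow>
    ('m \<Rightarrow> ('e \<Rightarrow> 'e) set) \<Rightarrow> ('m, 'e) conn \<Rightarrow> bool" where
  "preserves_Q A Q D \<longleftrightarrow> (\<forall>U S. open U \<and> smooth_End A U S \<and> (\<forall>q\<in>U. S q \<in> Q q) \<longrightarrow>
     (\<forall>p\<in>U. \<forall>u. cov_End A D S p u \<in> Q p))"

text \<open>The last clause says that the torsion is \<open>T\<^sup>H + \<Sum>\<^sub>a \<partial>(\<tau>\<^sub>a \<otimes> J\<^sub>a)\<close> for each admissible basis.\<close>

definition unimodular_oproiu :: "nat \<Rightarrow> ('m::topological_space, 'e::euclidean_space) atlas \<Rightarrow>
    ('m \<Rightarrow> ('e \<Rightarrow> 'e) set) \<Rightarrow> ('m \<Rightarrow> 'e \<Rightarrow> 'e \<Rightarrow> real) \<Rightarrow> ('m, 'e) conn \<Rightarrow> bool" where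
  "unimodular_oproiu n A Q \<omega> D \<longleftrightarrow>
     connection_on A UNIV D \<and> preserves_Q A Q D \<and> preserves_vol n A \<omega> D \<and>
     (\<forall>U J DH. admissible_basis A Q U J \<and> obata_connection A U J DH \<longrightarrow>
        (\<forall>W X Y. open W \<and> W \<subseteq> U \<and> smooth_field A W X \<and> smooth_field A W Y \<longrightarrow>
           (\<forall>p\<in>W. torsion A D X Y p = torsion A DH X Y p +
              (\<Sum>a\<in>{1,2,3}. tau n A DH (J a) p (X p) *\<^sub>R J a p (Y p)
                          - tau n A DH (J a) p (Y p) *\<^sub>R J a p (X p)))))"

definition adapted_diff :: "('m, 'e::euclidean_space) atlas \<Rightarrow> ('m \<Rightarrow> 'e \<Rightarrow> 'e \<Rightarrow> real) \<Rightarrow>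
    ('m, 'e) conn \<Rightarrow> 'm \<Rightarrow> 'e \<Rightarrow> 'e \<Rightarrow> 'e" where
  "adapted_diff A \<omega> D p u v = (THE a. \<forall>w. \<omega> p a w = (1/2) * cov_form A D \<omega> p u v w)"

text \<open>\<open>\<nabla>\<^sup>Q\<^sup>,\<^sup>\<omega>\<close>, where \<open>D\<close> is the unimodular Oproiu connection.\<close>

definition adapted_connection :: "('m, 'e::euclidean_space) atlas \<Rightarrow> ('m \<Rightarrow> 'e \<Rightarrow> 'e \<Rightarrow> real) \<Rightarrow>
    ('m, 'e) conn \<Rightarrow> ('m, 'e) conn" where
  "adapted_connection A \<omega> D = (\<lambda>Y p u. D Y p u + adapted_diff A \<omega> D p u (Y p))"

definition connection_forms :: "('m, 'e::euclidean_space) atlas \<Rightarrow> ('m, 'e) conn \<Rightarrow> 'm set \<Rightarrow>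
    (nat \<Rightarrow> 'm \<Rightarrow> 'e \<Rightarrow> 'e) \<Rightarrow> (nat \<Rightarrow> 'm \<Rightarrow> 'e \<Rightarrow> real) \<Rightarrow> bool" where
  "connection_forms A D U J \<gamma> \<longleftrightarrow>
     (\<forall>(a, b, c)\<in>{(1,2,3), (2,3,1), (3,1,2)}. \<forall>p\<in>U. \<forall>u v.
        cov_End A D (J a) p u v = \<gamma> c p u *\<^sub>R J b p v - \<gamma> b p u *\<^sub>R J c p v)"

definition type_X15 :: "('m, 'e::euclidean_space) atlas \<Rightarrow> ('m \<Rightarrow> 'e \<Rightarrow> 'e \<Rightarrow> real) \<Rightarrow> bool" where
  "type_X15 A \<omega> \<longleftrightarrow> closed_form A \<omega>"

text \<open>
  \<open>D\<close> is the unimodular Oproiu connection; its torsion is \<open>T\<^sup>Q\<close>, whose vanishing means that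
  \<open>Q\<close> is quaternionic.
\<close>

definition type_X5 :: "('m::topological_space, 'e::euclidean_space) atlas \<Rightarrow>
    ('m \<Rightarrow> 'e \<Rightarrow> 'e \<Rightarrow> real) \<Rightarrow> ('m, 'e) conn \<Rightarrow> bool" where
  "type_X5 A \<omega> D \<longleftrightarrow> closed_form A \<omega> \<and> torsion_free A D"

definition qsH_torsion_free :: "('m::topological_space, 'e::euclidean_space) atlas \<Rightarrow>
    ('m \<Rightarrow> 'e \<Rightarrow> 'e \<Rightarrow> real) \<Rightarrow> ('m, 'e) conn \<Rightarrow> bool" where
  "qsH_torsion_free A \<omega> D \<longleftrightarrow> torsion_free A (adapted_connection A \<omega> D)"

definition submanifold :: "('m::topological_space, 'e::euclidean_space) atlas \<Rightarrow>
    ('n::{t2_space,second_countable_topology}, 'f::euclidean_space) atlas \<Rightarrow> ('n \<Rightarrow> 'm) \<Rightarrow> bool" where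
  "submanifold A B \<iota> \<longleftrightarrow> smooth_atlas B \<and> smooth_map A B \<iota> \<and> inj \<iota> \<and>
     (\<forall>x. inj (tmap A B \<iota> x))"

text \<open>Smooth sections along \<open>\<iota>\<close> of \<open>Q\<close>, that is, smooth sections of the pullback bundle.\<close>

definition section_along :: "('m, 'e::euclidean_space) atlas \<Rightarrow> ('m \<Rightarrow> ('e \<Rightarrow> 'e) set) \<Rightarrow>
    ('n, 'f::euclidean_space) atlas \<Rightarrow> ('n \<Rightarrow> 'm) \<Rightarrow> ('n \<Rightarrow> 'e \<Rightarrow> 'e) \<Rightarrow> bool" where
  "section_along A Q B \<iota> S \<longleftrightarrow> (\<forall>x. S x \<in> Q (\<iota> x)) \<and>
     (\<forall>c\<in>A. \<forall>w. smooth_fun B (\<iota> -` cdom c)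
        (\<lambda>x. tcoord A c (\<iota> x) (S x (coord_field A c w (\<iota> x)))))"

definition almost_complex_submanifold :: "('m::topological_space, 'e::euclidean_space) atlas \<Rightarrow>
    ('m \<Rightarrow> ('e \<Rightarrow> 'e) set) \<Rightarrow>
    ('n::{t2_space,second_countable_topology}, 'f::euclidean_space) atlas \<Rightarrow>
    ('n \<Rightarrow> 'm) \<Rightarrow> ('n \<Rightarrow> 'f \<Rightarrow> 'f) \<Rightarrow> bool" where
  "almost_complex_submanifold A Q B \<iota> Jh \<longleftrightarrow> submanifold A B \<iota> \<and> almost_complex B Jh \<and>
     (\<exists>S. section_along A Q B \<iota> S \<and>
        (\<forall>x v. tmap A B \<iota> x (Jh x v) = S x (tmap A B \<iota> x v)))"

definition pullback_form :: "('m, 'e::euclidean_space) atlas \<Rightarrow> ('n, 'f::euclidean_space) atlas \<Rightarrow>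
    ('n \<Rightarrow> 'm) \<Rightarrow> ('m \<Rightarrow> 'e \<Rightarrow> 'e \<Rightarrow> real) \<Rightarrow> 'n \<Rightarrow> 'f \<Rightarrow> 'f \<Rightarrow> real" where
  "pullback_form A B \<iota> \<omega> = (\<lambda>x u v. \<omega> (\<iota> x) (tmap A B \<iota> x u) (tmap A B \<iota> x v))"

definition almost_pseudo_hermitian_submanifold ::
  "('m::topological_space, 'e::euclidean_space) atlas \<Rightarrow> ('m \<Rightarrow> ('e \<Rightarrow> 'e) set) \<Rightarrow>
    ('m \<Rightarrow> 'e \<Rightarrow> 'e \<Rightarrow> real) \<Rightarrow>
    ('n::{t2_space,second_countable_topology}, 'f::euclidean_space) atlas \<Rightarrow> ('n \<Rightarrow> 'm) \<Rightarrow>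
    ('n \<Rightarrow> 'f \<Rightarrow> 'f) \<Rightarrow> ('n \<Rightarrow> 'f \<Rightarrow> 'f \<Rightarrow> real) \<Rightarrow> ('n \<Rightarrow> 'f \<Rightarrow> 'f \<Rightarrow> real) \<Rightarrow> bool" where
  "almost_pseudo_hermitian_submanifold A Q \<omega> B \<iota> Jh \<omega>h gh \<longleftrightarrow>
     almost_complex_submanifold A Q B \<iota> Jh \<and>
     \<omega>h = pullback_form A B \<iota> \<omega> \<and> nondegenerate \<omega>h \<and>
     gh = (\<lambda>x u v. \<omega>h x u (Jh x v))"

definition almost_pseudo_kaehler_submanifold ::
  "('m::topological_space, 'e::euclidean_space) atlas \<Rightarrow> ('m \<Rightarrow> ('e \<Rightarrow> 'e) set) \<Rightarrow>
    ('m \<Rightarrow> 'e \<Rightarrow> 'e \<Rightarrow> real) \<Rightarrow>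
    ('n::{t2_space,second_countable_topology}, 'f::euclidean_space) atlas \<Rightarrow> ('n \<Rightarrow> 'm) \<Rightarrow>
    ('n \<Rightarrow> 'f \<Rightarrow> 'f) \<Rightarrow> ('n \<Rightarrow> 'f \<Rightarrow> 'f \<Rightarrow> real) \<Rightarrow> ('n \<Rightarrow> 'f \<Rightarrow> 'f \<Rightarrow> real) \<Rightarrow> bool" where
  "almost_pseudo_kaehler_submanifold A Q \<omega> B \<iota> Jh \<omega>h gh \<longleftrightarrow>
     almost_pseudo_hermitian_submanifold A Q \<omega> B \<iota> Jh \<omega>h gh \<and> closed_form B \<omega>h"

definition pseudo_kaehler_submanifold ::
  "('m::topological_space, 'e::euclidean_space) atlas \<Rightarrow> ('m \<Rightarrow> ('e \<Rightarrow> 'e) set) \<Rightarrow>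
    ('m \<Rightarrow> 'e \<Rightarrow> 'e \<Rightarrow> real) \<Rightarrow>
    ('n::{t2_space,second_countable_topology}, 'f::euclidean_space) atlas \<Rightarrow> ('n \<Rightarrow> 'm) \<Rightarrow>
    ('n \<Rightarrow> 'f \<Rightarrow> 'f) \<Rightarrow> ('n \<Rightarrow> 'f \<Rightarrow> 'f \<Rightarrow> real) \<Rightarrow> ('n \<Rightarrow> 'f \<Rightarrow> 'f \<Rightarrow> real) \<Rightarrow> bool" where
  "pseudo_kaehler_submanifold A Q \<omega> B \<iota> Jh \<omega>h gh \<longleftrightarrow>
     almost_pseudo_kaehler_submanifold A Q \<omega> B \<iota> Jh \<omega>h gh \<and> integrable_acs B Jh"

text \<open>
  Since \<open>\<iota>\<close> need not be an embedding, a local adapted basis consists of an open \<open>V \<subseteq> N\<close> and an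
  admissible basis on an open \<open>U \<supseteq> \<iota>(V)\<close> with \<open>J\<^sub>1 = Jh\<close> on \<open>TV\<close>.
\<close>

definition adapted_basis :: "('m::topological_space, 'e::euclidean_space) atlas \<Rightarrow>
    ('m \<Rightarrow> ('e \<Rightarrow> 'e) set) \<Rightarrow> ('n::topological_space, 'f::euclidean_space) atlas \<Rightarrow>
    ('n \<Rightarrow> 'm) \<Rightarrow> ('n \<Rightarrow> 'f \<Rightarrow> 'f) \<Rightarrow> 'n set \<Rightarrow> 'm set \<Rightarrow> (nat \<Rightarrow> 'm \<Rightarrow> 'e \<Rightarrow> 'e) \<Rightarrow> bool" where
  "adapted_basis A Q B \<iota> Jh V U J \<longleftrightarrow>
     open V \<and> \<iota> ` V \<subseteq> U \<and> admissible_basis A Q U J \<and>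
     (\<forall>x\<in>V. \<forall>v. J 1 (\<iota> x) (tmap A B \<iota> x v) = tmap A B \<iota> x (Jh x v))"

text \<open>
  As adapted bases exist only locally, a choice of adapted bases is a family
  \<open>(V, U, J, \<gamma>)\<close> whose sets \<open>V\<close> cover \<open>N\<close>, each with its 1-forms \<open>\<gamma>\<^sub>a\<close> for the connection \<open>D\<close>.
\<close>

definition adapted_family :: "('m::topological_space, 'e::euclidean_space) atlas \<Rightarrow>
    ('m \<Rightarrow> ('e \<Rightarrow> 'e) set) \<Rightarrow> ('m, 'e) conn \<Rightarrow>
    ('n::topological_space, 'f::euclidean_space) atlas \<Rightarrow> ('n \<Rightarrow> 'm) \<Rightarrow> ('n \<Rightarrow> 'f \<Rightarrow> 'f) \<Rightarrow>
    ('n set \<times> 'm set \<times> (nat \<Rightarrow> 'm \<Rightarrow> 'e \<Rightarrow> 'e) \<times> (nat \<Rightarrow> 'm \<Rightarrow> 'e \<Rightarrow> real)) set \<Rightarrow> bool" where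
  "adapted_family A Q D B \<iota> Jh F \<longleftrightarrow>
     (\<forall>(V, U, J, \<gamma>)\<in>F. adapted_basis A Q B \<iota> Jh V U J \<and> connection_forms A D U J \<gamma>) \<and>
     (\<Union>(V, U, J, \<gamma>)\<in>F. V) = UNIV"

definition psi :: "(nat \<Rightarrow> 'm \<Rightarrow> 'e \<Rightarrow> 'e) \<Rightarrow> (nat \<Rightarrow> 'm \<Rightarrow> 'e \<Rightarrow> real) \<Rightarrow> 'm \<Rightarrow> 'e \<Rightarrow> real" where
  "psi J \<gamma> p u = \<gamma> 3 p (J 1 p u) - \<gamma> 2 p u"

definition psi_vanishes :: "('m, 'e::euclidean_space) atlas \<Rightarrow>
    ('n, 'f::euclidean_space) atlas \<Rightarrow> ('n \<Rightarrow> 'm) \<Rightarrow>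
    ('n set \<times> 'm set \<times> (nat \<Rightarrow> 'm \<Rightarrow> 'e \<Rightarrow> 'e) \<times> (nat \<Rightarrow> 'm \<Rightarrow> 'e \<Rightarrow> real)) set \<Rightarrow> bool" where
  "psi_vanishes A B \<iota> F \<longleftrightarrow>
     (\<forall>(V, U, J, \<gamma>)\<in>F. \<forall>x\<in>V. \<forall>v. psi J \<gamma> (\<iota> x) (tmap A B \<iota> x v) = 0)"

end

theory Submission
  imports Defs
begin

text \<open>
  In either case there is a torsion-free connection for which \<open>\<nabla>J\<^sub>1 = \<gamma>\<^sub>3 \<otimes> J\<^sub>2 - \<gamma>\<^sub>2 \<otimes> J\<^sub>3\<close>:
  the adapted connection itself if it is torsion-free, and the unimodular Oproiu connection in type
  \<open>X\<^sub>5\<close>, because there the difference of the two connections commutes with \<open>J\<^sub>1\<close>.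
  Expressing the Nijenhuis tensor through such a connection gives
  \<open>N(u,v) = \<psi>(u) J\<^sub>2 v - \<psi>(v) J\<^sub>2 u + \<psi>(J\<^sub>1 u) J\<^sub>3 v - \<psi>(J\<^sub>1 v) J\<^sub>3 u\<close>,
  whose restriction is the Nijenhuis tensor of the submanifold.  If it vanishes on \<open>TN\<close>, applying
  \<open>J\<^sub>2\<close> gives \<open>(\<psi>(u) - \<psi>(J\<^sub>1 u) J\<^sub>1) v \<in> span {u, J\<^sub>1 u}\<close>, which forces \<open>\<psi>(u) = 0\<close>
  as soon as \<open>v\<close> can be chosen outside this plane.  That \<open>N\<close> and \<open>d\<omega>\<close> restrict to submanifolds is
  the symmetry of the second derivatives of \<open>\<iota>\<close> in charts.
\<close>

section \<open>Functions of class \<open>C\<^sup>k\<close>\<close>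

text \<open>The obstacle is the encoding of tangent vectors: each tangent space is identified with
  the model space by a chart that jumps from point to point, so a field must not be differentiated
  as a plain map. Near a point p everything is therefore read in the single chart chosen at p, held
  fixed while the base point moves. In that chart an endomorphism field and a 2-form have partial
  derivatives, a connection has coefficients, and \<iota> has second derivatives. None of these is a
  tensor, but product rules relate them, and the chart-dependent terms cancel in the tensors of
  interest. After that, the quaternionic argument is linear algebra in one tangent space.\<close>

lemma frechet_derivative_eq:
  "(f has_derivative f') (at x) \<Longrightarrow> frechet_derivative f (at x) = f'"
  using frechet_derivative_at by metis

text \<open>Openness lets the induction descend: functions that agree on an open set have the same
  derivatives at its points.\<close>

lemma Ck_on_cong:
  assumes "open S" and "\<And>x. x \<in> S \<Longrightarrow> f x = g x" and "Ck_on k S f"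
  shows "Ck_on k S g"
  using assms(2,3)
proof (induction k arbitrary: f g)
  case 0
  then show ?case using continuous_on_cong by force
next
  case (Suc k)
  have D: "(g has_derivative frechet_derivative f (at x)) (at x)" if "x \<in> S" for x
  proof (rule has_derivative_transform_within_open[OF _ \<open>open S\<close> that])
    show "(f has_derivative frechet_derivative f (at x)) (at x)"
      using Suc.prems(2) that frechet_derivative_works by auto
  qed (use Suc.prems(1) in auto)
  have "Ck_on k S (\<lambda>x. frechet_derivative g (at x) v)" for v
  proof (rule Suc.IH)
    show "Ck_on k S (\<lambda>x. frechet_derivative f (at x) v)" using Suc.prems(2) by auto
  qed (simp add: frechet_derivative_eq[OF D])
  then show ?case using D by (auto simp: differentiable_def)
qed

lemma Ck_on_subset: "Ck_on k S f \<Longrightarrow> T \<subseteq> S \<Longrightarrow> Ck_on k T f"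
  by (induction k arbitrary: f) (auto intro: continuous_on_subset)

lemma Ck_on_SucD: "Ck_on (Suc k) S f \<Longrightarrow> Ck_on k S f"
proof (induction k arbitrary: f)
  case 0
  then show ?case
    by (auto intro!: continuous_at_imp_continuous_on differentiable_imp_continuous_within)
next
  case (Suc k)
  then show ?case by (metis Ck_on.simps(2))
qed

lemma Ck_on_const: "Ck_on k S (\<lambda>x. c)"
proof (induction k arbitrary: c)
  case 0
  then show ?case by simp
next
  case (Suc k)
  then show ?case by simp
qed

lemma Ck_on_linear:
  assumes "bounded_linear L" and "Ck_on k S f" and "open S"
  shows "Ck_on k S (\<lambda>x. L (f x))"
  using assms(2)
proof (induction k arbitrary: f)
  case 0
  then show ?case using bounded_linear.continuous_on[OF assms(1)] by simp
next
  case (Suc k)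
  have D: "((\<lambda>x. L (f x)) has_derivative (\<lambda>v. L (frechet_derivative f (at x) v))) (at x)"
    if "x \<in> S" for x
    using Suc.prems that frechet_derivative_works
    by (auto intro!: bounded_linear.has_derivative[OF assms(1)])
  have "Ck_on k S (\<lambda>x. frechet_derivative (\<lambda>x. L (f x)) (at x) v)" for v
  proof (rule Ck_on_cong[OF \<open>open S\<close>])
    show "Ck_on k S (\<lambda>x. L (frechet_derivative f (at x) v))" using Suc by auto
  qed (simp add: frechet_derivative_eq[OF D])
  then show ?case using D by (auto simp: differentiable_def)
qed

lemma Ck_on_add:
  assumes "Ck_on k S f" and "Ck_on k S g" and "open S"
  shows "Ck_on k S (\<lambda>x. f x + g x)"
  using assms(1,2)
proof (induction k arbitrary: f g)
  case 0
  then show ?case by (auto intro: continuous_intros)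
next
  case (Suc k)
  have D: "((\<lambda>x. f x + g x) has_derivative
      (\<lambda>v. frechet_derivative f (at x) v + frechet_derivative g (at x) v)) (at x)"
    if "x \<in> S" for x
    using Suc.prems that frechet_derivative_works by (auto intro!: has_derivative_add)
  have "Ck_on k S (\<lambda>x. frechet_derivative (\<lambda>x. f x + g x) (at x) v)" for v
  proof (rule Ck_on_cong[OF \<open>open S\<close>])
    show "Ck_on k S (\<lambda>x. frechet_derivative f (at x) v + frechet_derivative g (at x) v)"
      using Suc by auto
  qed (simp add: frechet_derivative_eq[OF D])
  then show ?case using D by (auto simp: differentiable_def)
qed

lemma Ck_on_scaleR:
  assumes "Ck_on k S f" and "Ck_on k S g" and "open S"
  shows "Ck_on k S (\<lambda>x. f x *\<^sub>R g x)"
  using assms(1,2)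
proof (induction k arbitrary: f g)
  case 0
  then show ?case by (auto intro: continuous_intros)
next
  case (Suc k)
  have D: "((\<lambda>x. f x *\<^sub>R g x) has_derivative
      (\<lambda>v. f x *\<^sub>R frechet_derivative g (at x) v + frechet_derivative f (at x) v *\<^sub>R g x)) (at x)"
    if "x \<in> S" for x
    using Suc.prems that
    by (auto intro!: has_derivative_scaleR simp: frechet_derivative_works[symmetric])
  have "Ck_on k S (\<lambda>x. frechet_derivative (\<lambda>x. f x *\<^sub>R g x) (at x) v)" for v
  proof (rule Ck_on_cong[OF \<open>open S\<close>])
    \<comment> \<open>Each term of the product rule keeps one factor undifferentiated; that factor
      is lowered from order \<open>Suc k\<close> to order \<open>k\<close> before the induction
      hypothesis applies.\<close>
    show "Ck_on k S (\<lambda>x. f x *\<^sub>R frechet_derivative g (at x) v + frechet_derivative f (at x) v *\<^sub>R g x)"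
      using Suc Ck_on_SucD[OF Suc.prems(1)] Ck_on_SucD[OF Suc.prems(2)]
      by (intro Ck_on_add \<open>open S\<close> Suc.IH) auto
  qed (simp add: frechet_derivative_eq[OF D])
  then show ?case using D by (auto simp: differentiable_def)
qed

lemma Ck_on_sum:
  assumes "\<And>i. i \<in> I \<Longrightarrow> Ck_on k S (f i)" and "open S"
  shows "Ck_on k S (\<lambda>x. \<Sum>i\<in>I. f i x)"
  using assms(1)
proof (induction I rule: infinite_finite_induct)
  case (insert i I)
  then have "Ck_on k S (\<lambda>x. f i x + (\<Sum>i\<in>I. f i x))" by (intro Ck_on_add assms(2)) auto
  then show ?case using insert by simp
qed (simp_all add: Ck_on_const)

lemma linear_eq_sum_Basis:
  assumes "linear f"
  shows "f (x::'a::euclidean_space) = (\<Sum>i\<in>Basis. (x \<bullet> i) *\<^sub>R f i)"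
proof -
  have "f x = f (\<Sum>i\<in>Basis. (x \<bullet> i) *\<^sub>R i)" by (simp add: euclidean_representation)
  then show ?thesis by (simp add: linear_sum[OF assms] linear_cmul[OF assms])
qed

text \<open>\<open>Ck_on\<close> speaks of derivatives in fixed directions, whereas the chain rule
  differentiates \<open>f\<close> in the moving direction given by the derivative of
  \<open>g\<close>. Expanding that direction in the basis leaves scalar coefficients times
  fixed-direction derivatives of \<open>f\<close> composed with \<open>g\<close>, to which induction
  applies.\<close>

lemma Ck_on_compose:
  fixes g :: "'a::real_normed_vector \<Rightarrow> 'b::euclidean_space"
  assumes "Ck_on k T f" and "Ck_on k S g" and "open S" and "open T" and "g ` S \<subseteq> T"
  shows "Ck_on k S (f \<circ> g)"
  using assms(1,2)
proof (induction k arbitrary: f)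
  case 0
  then show ?case
    using continuous_on_compose[of S g f] continuous_on_subset[of T f, OF _ assms(5)] by auto
next
  case (Suc k)
  have D: "((f \<circ> g) has_derivative
      (frechet_derivative f (at (g x)) \<circ> frechet_derivative g (at x))) (at x)" if "x \<in> S" for x
    using Suc.prems that assms(5)
    by (intro diff_chain_at) (auto simp: frechet_derivative_works[symmetric])
  have lin: "linear (frechet_derivative f (at (g x)))" if "x \<in> S" for x
    using that Suc.prems assms(5) linear_frechet_derivative by auto
  have "Ck_on k S (\<lambda>x. frechet_derivative (f \<circ> g) (at x) v)" for v
  proof (rule Ck_on_cong[OF \<open>open S\<close>])
    show "Ck_on k S (\<lambda>x. \<Sum>i\<in>Basis. (frechet_derivative g (at x) v \<bullet> i) *\<^sub>R
        ((\<lambda>y. frechet_derivative f (at y) i) \<circ> g) x)"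
      using Suc Ck_on_SucD[OF Suc.prems(2)]
      by (intro Ck_on_sum Ck_on_scaleR \<open>open S\<close> Suc.IH Ck_on_linear[OF bounded_linear_inner_left]) auto
  next
    show "(\<Sum>i\<in>Basis. (frechet_derivative g (at x) v \<bullet> i) *\<^sub>R
        ((\<lambda>y. frechet_derivative f (at y) i) \<circ> g) x) = frechet_derivative (f \<circ> g) (at x) v"
      if "x \<in> S" for x
      using linear_eq_sum_Basis[OF lin[OF that], of "frechet_derivative g (at x) v"]
      by (simp add: frechet_derivative_eq[OF D[OF that]])
  qed
  then show ?case using D unfolding Ck_on.simps differentiable_def by blast
qed

lemma smooth_on_cong:
  "smooth_on S f \<Longrightarrow> open S \<Longrightarrow> (\<And>x. x \<in> S \<Longrightarrow> f x = g x) \<Longrightarrow> smooth_on S g"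
  unfolding smooth_on_def using Ck_on_cong by blast

lemma smooth_on_subset: "smooth_on S f \<Longrightarrow> T \<subseteq> S \<Longrightarrow> smooth_on T f"
  unfolding smooth_on_def using Ck_on_subset by blast

lemma smooth_on_const: "smooth_on S (\<lambda>x. c)"
  unfolding smooth_on_def using Ck_on_const by blast

lemma smooth_on_add:
  "smooth_on S f \<Longrightarrow> smooth_on S g \<Longrightarrow> open S \<Longrightarrow> smooth_on S (\<lambda>x. f x + g x)"
  unfolding smooth_on_def using Ck_on_add by blast

lemma smooth_on_scaleR:
  "smooth_on S f \<Longrightarrow> smooth_on S g \<Longrightarrow> open S \<Longrightarrow> smooth_on S (\<lambda>x. f x *\<^sub>R g x)"
  unfolding smooth_on_def using Ck_on_scaleR by blast

lemma smooth_on_linear: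
  "bounded_linear L \<Longrightarrow> smooth_on S f \<Longrightarrow> open S \<Longrightarrow> smooth_on S (\<lambda>x. L (f x))"
  unfolding smooth_on_def using Ck_on_linear by blast

lemma smooth_on_compose:
  fixes g :: "'a::real_normed_vector \<Rightarrow> 'b::euclidean_space"
  shows "smooth_on T f \<Longrightarrow> smooth_on S g \<Longrightarrow> open S \<Longrightarrow> open T \<Longrightarrow> g ` S \<subseteq> T \<Longrightarrow>
    smooth_on S (f \<circ> g)"
  unfolding smooth_on_def using Ck_on_compose by blast

lemma smooth_on_frechet_derivative:
  "smooth_on S f \<Longrightarrow> smooth_on S (\<lambda>x. frechet_derivative f (at x) v)"
  unfolding smooth_on_def by (metis Ck_on.simps(2))

lemma smooth_on_has_derivative:
  "smooth_on S f \<Longrightarrow> x \<in> S \<Longrightarrow> (f has_derivative frechet_derivative f (at x)) (at x)"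
  unfolding smooth_on_def using frechet_derivative_works by (metis Ck_on.simps(2))

lemma smooth_on_continuous: "smooth_on S f \<Longrightarrow> continuous_on S f"
  unfolding smooth_on_def by (metis Ck_on.simps(1))

section \<open>Symmetry of second derivatives\<close>

lemma DERIV_along_line:
  fixes f :: "'a::real_normed_vector \<Rightarrow> real"
  assumes "(f has_derivative f') (at (x + t *\<^sub>R u))"
  shows "((\<lambda>t. f (x + t *\<^sub>R u)) has_real_derivative f' u) (at t)"
proof -
  have "((\<lambda>t. f (x + t *\<^sub>R u)) has_derivative (\<lambda>h. f' (h *\<^sub>R u))) (at t)"
    by (rule has_derivative_compose[of "\<lambda>t. x + t *\<^sub>R u", OF _ assms])
       (auto intro!: derivative_eq_intros)
  moreover have "(\<lambda>h. f' (h *\<^sub>R u)) = (*) (f' u)"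
    using has_derivative_bounded_linear[OF assms] linear_cmul[OF bounded_linear.linear]
    by (fastforce simp: mult.commute)
  ultimately show ?thesis by (simp add: has_field_derivative_def)
qed

text \<open>Two uses of the mean value theorem: along \<open>u\<close> for the increment of
  \<open>f\<close> by \<open>h *\<^sub>R v\<close>, then along \<open>v\<close> for the derivative
  of \<open>f\<close> in direction \<open>u\<close>. The bound on \<open>h\<close> keeps the whole
  parallelogram inside the ball.\<close>

lemma second_difference_MVT:
  fixes f :: "'a::real_normed_vector \<Rightarrow> real"
  assumes f: "smooth_on (ball x r) f" and h: "0 < h" "h * (norm u + norm v) < r"
  obtains y where "y \<in> ball x r"
    "f (x + h *\<^sub>R u + h *\<^sub>R v) - f (x + h *\<^sub>R u) - f (x + h *\<^sub>R v) + f x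
      = h * h * frechet_derivative (\<lambda>y. frechet_derivative f (at y) u) (at y) v"
proof -
  define fu where "fu y = frechet_derivative f (at y) u" for y
  have fu: "smooth_on (ball x r) fu"
    unfolding fu_def by (rule smooth_on_frechet_derivative[OF f])
  have inb: "x + s *\<^sub>R u + t *\<^sub>R v \<in> ball x r" if "0 \<le> s" "s \<le> h" "0 \<le> t" "t \<le> h" for s t
  proof -
    have "norm (s *\<^sub>R u + t *\<^sub>R v) \<le> s * norm u + t * norm v"
      using that norm_triangle_ineq[of "s *\<^sub>R u" "t *\<^sub>R v"] by simp
    also have "\<dots> \<le> h * norm u + h * norm v"
      using that by (intro add_mono mult_right_mono) auto
    also have "\<dots> < r" using h by (simp add: distrib_left)
    finally have "dist (x + (s *\<^sub>R u + t *\<^sub>R v)) x < r" unfolding dist_norm by simp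
    then show ?thesis by (simp only: mem_ball add.assoc dist_commute[of x])
  qed
  have "\<exists>\<xi>>0. \<xi> < h \<and>
      (f (x + h *\<^sub>R v + h *\<^sub>R u) - f (x + h *\<^sub>R u)) - (f (x + h *\<^sub>R v + 0 *\<^sub>R u) - f (x + 0 *\<^sub>R u))
       = (h - 0) * (fu (x + h *\<^sub>R v + \<xi> *\<^sub>R u) - fu (x + \<xi> *\<^sub>R u))"
  proof (rule MVT2[OF h(1)])
    fix t assume "0 \<le> t" "t \<le> h"
    then show "((\<lambda>t. f (x + h *\<^sub>R v + t *\<^sub>R u) - f (x + t *\<^sub>R u)) has_real_derivative
        fu (x + h *\<^sub>R v + t *\<^sub>R u) - fu (x + t *\<^sub>R u)) (at t)"
      unfolding fu_def using inb[of t h] inb[of t 0] h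
      by (intro DERIV_diff DERIV_along_line smooth_on_has_derivative[OF f]) (auto simp: algebra_simps)
  qed
  then obtain \<xi> where \<xi>: "0 < \<xi>" "\<xi> < h" and
    1: "f (x + h *\<^sub>R v + h *\<^sub>R u) - f (x + h *\<^sub>R u) - (f (x + h *\<^sub>R v) - f x)
       = h * (fu (x + h *\<^sub>R v + \<xi> *\<^sub>R u) - fu (x + \<xi> *\<^sub>R u))"
    by auto
  have "\<exists>\<eta>>0. \<eta> < h \<and> fu (x + \<xi> *\<^sub>R u + h *\<^sub>R v) - fu (x + \<xi> *\<^sub>R u + 0 *\<^sub>R v)
       = (h - 0) * frechet_derivative fu (at (x + \<xi> *\<^sub>R u + \<eta> *\<^sub>R v)) v"
    using inb \<xi> by (intro MVT2[OF h(1)] DERIV_along_line smooth_on_has_derivative[OF fu]) auto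
  then obtain \<eta> where \<eta>: "0 < \<eta>" "\<eta> < h" and
    2: "fu (x + \<xi> *\<^sub>R u + h *\<^sub>R v) - fu (x + \<xi> *\<^sub>R u)
       = h * frechet_derivative fu (at (x + \<xi> *\<^sub>R u + \<eta> *\<^sub>R v)) v"
    by auto
  show thesis
  proof (rule that)
    show "x + \<xi> *\<^sub>R u + \<eta> *\<^sub>R v \<in> ball x r" using inb \<xi> \<eta> by simp
    show "f (x + h *\<^sub>R u + h *\<^sub>R v) - f (x + h *\<^sub>R u) - f (x + h *\<^sub>R v) + f x
      = h * h * frechet_derivative (\<lambda>y. frechet_derivative f (at y) u) (at (x + \<xi> *\<^sub>R u + \<eta> *\<^sub>R v)) v"
      using 1 2 unfolding fu_def[symmetric] by (simp add: algebra_simps)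
  qed
qed

text \<open>The second difference does not change when \<open>u\<close> and \<open>v\<close> are
  exchanged, so the two mixed derivatives agree at points \<open>y1\<close> and \<open>y2\<close>
  arbitrarily close to \<open>x\<close>; continuity of both carries the equality to
  \<open>x\<close>.\<close>

lemma second_derivative_symmetric_real:
  fixes f :: "'a::real_normed_vector \<Rightarrow> real"
  assumes f: "smooth_on S f" and S: "open S" "x \<in> S"
  shows "frechet_derivative (\<lambda>y. frechet_derivative f (at y) u) (at x) v
       = frechet_derivative (\<lambda>y. frechet_derivative f (at y) v) (at x) u"
proof -
  define D where "D u v y = frechet_derivative (\<lambda>y. frechet_derivative f (at y) u) (at y) v" for u v y
  have cont: "continuous (at x) (D u v)" for u v
    unfolding D_def
    using smooth_on_continuous[OF smooth_on_frechet_derivative[OF smooth_on_frechet_derivative[OF f]]] S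
    by (simp add: continuous_on_eq_continuous_at)
  have "\<bar>D u v x - D v u x\<bar> \<le> e" if e: "e > 0" for e
  proof -
    obtain d1 where d1: "d1 > 0" "\<And>y. dist y x < d1 \<Longrightarrow> dist (D u v y) (D u v x) < e / 2"
      using cont[of u v] half_gt_zero[OF e] unfolding continuous_at_eps_delta by metis
    obtain d2 where d2: "d2 > 0" "\<And>y. dist y x < d2 \<Longrightarrow> dist (D v u y) (D v u x) < e / 2"
      using cont[of v u] half_gt_zero[OF e] unfolding continuous_at_eps_delta by metis
    obtain d3 where d3: "d3 > 0" "ball x d3 \<subseteq> S" using S open_contains_ball by blast
    define r where "r = min d1 (min d2 d3)"
    \<comment> \<open>The summand 1 keeps the divisor positive when \<open>u\<close> and
      \<open>v\<close> are both 0, and the factor 2 in \<open>h\<close> makes the bound on the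
      parallelogram strict.\<close>
    define c where "c = norm u + norm v + 1"
    define h where "h = r / (2 * c)"
    have r: "r > 0" "ball x r \<subseteq> S" using d1 d2 d3 by (auto simp: r_def)
    have pos: "c > 0" by (simp add: c_def add_nonneg_pos)
    have h: "h > 0" using r pos by (simp add: h_def)
    have "h * (norm u + norm v) \<le> h * c" using h by (simp add: c_def)
    also have "\<dots> = r / 2" using pos by (simp add: h_def)
    also have "\<dots> < r" using r by simp
    finally have hr: "h * (norm u + norm v) < r" .
    have fr: "smooth_on (ball x r) f" using smooth_on_subset[OF f] r by simp
    obtain y1 where y1: "y1 \<in> ball x r"
      "f (x + h *\<^sub>R u + h *\<^sub>R v) - f (x + h *\<^sub>R u) - f (x + h *\<^sub>R v) + f x = h * h * D u v y1"
      using second_difference_MVT[OF fr h hr] unfolding D_def by blast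
    have hr': "h * (norm v + norm u) < r" using hr by (simp add: add.commute)
    obtain y2 where y2: "y2 \<in> ball x r"
      "f (x + h *\<^sub>R v + h *\<^sub>R u) - f (x + h *\<^sub>R v) - f (x + h *\<^sub>R u) + f x = h * h * D v u y2"
      using second_difference_MVT[OF fr h hr'] unfolding D_def by blast
    have "h * h * D u v y1 = h * h * D v u y2"
      using y1(2) y2(2) by (simp add: algebra_simps)
    then have "D u v y1 = D v u y2" using h by simp
    moreover have "dist (D u v y1) (D u v x) < e / 2"
      using d1(2)[of y1] y1(1) by (simp add: r_def dist_commute)
    moreover have "dist (D v u y2) (D v u x) < e / 2"
      using d2(2)[of y2] y2(1) by (simp add: r_def dist_commute)
    ultimately show ?thesis unfolding dist_real_def by linarith
  qed
  then have "\<bar>D u v x - D v u x\<bar> \<le> 0" using field_le_epsilon[of "\<bar>D u v x - D v u x\<bar>" 0] by simp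
  then show ?thesis by (simp add: D_def)
qed

lemma second_derivative_symmetric:
  fixes f :: "'a::real_normed_vector \<Rightarrow> 'b::euclidean_space"
  assumes f: "smooth_on S f" and S: "open S" "x \<in> S"
  shows "frechet_derivative (\<lambda>y. frechet_derivative f (at y) u) (at x) v
       = frechet_derivative (\<lambda>y. frechet_derivative f (at y) v) (at x) u"
proof (rule euclidean_eqI)
  fix i :: 'b assume "i \<in> Basis"
  let ?f = "\<lambda>y. f y \<bullet> i"
  have f1: "frechet_derivative ?f (at y) w = frechet_derivative f (at y) w \<bullet> i" if "y \<in> S" for y w
    by (simp add: frechet_derivative_eq[OF has_derivative_inner_left[OF smooth_on_has_derivative[OF f that]]])
  have f2: "frechet_derivative (\<lambda>y. frechet_derivative ?f (at y) w) (at x) z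
      = frechet_derivative (\<lambda>y. frechet_derivative f (at y) w) (at x) z \<bullet> i" for w z
  proof -
    have "((\<lambda>y. frechet_derivative f (at y) w \<bullet> i) has_derivative
      (\<lambda>z. frechet_derivative (\<lambda>y. frechet_derivative f (at y) w) (at x) z \<bullet> i)) (at x)"
      by (intro has_derivative_inner_left smooth_on_has_derivative[OF smooth_on_frechet_derivative[OF f] S(2)])
    from has_derivative_transform_within_open[OF this S, of "\<lambda>y. frechet_derivative ?f (at y) w"]
    show ?thesis using frechet_derivative_eq f1 by metis
  qed
  have "smooth_on S ?f" by (rule smooth_on_linear[OF bounded_linear_inner_left f S(1)])
  from second_derivative_symmetric_real[OF this S, of u v]
  show "frechet_derivative (\<lambda>y. frechet_derivative f (at y) u) (at x) v \<bullet> i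
       = frechet_derivative (\<lambda>y. frechet_derivative f (at y) v) (at x) u \<bullet> i"
    unfolding f2 .
qed

section \<open>Product rules for families of linear and bilinear maps\<close>

text \<open>Differentiability is asked only for each fixed argument \<open>b\<close>, which is all
  that smoothness of a tensor field in coordinates provides. The basis expansion of the moving
  argument turns the expression into a finite sum of products.\<close>

lemma has_derivative_linear_family:
  fixes F :: "'a::real_normed_vector \<Rightarrow> 'b::euclidean_space \<Rightarrow> 'c::real_normed_vector"
  assumes S: "open S" "x \<in> S" and lin: "\<And>y. y \<in> S \<Longrightarrow> linear (F y)"
    and F: "\<And>b. ((\<lambda>y. F y b) has_derivative (\<lambda>h. F' h b)) (at x)"
    and a: "(a has_derivative a') (at x)"
  shows "((\<lambda>y. F y (a y)) has_derivative (\<lambda>h. F' h (a x) + F x (a' h))) (at x)"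
proof -
  have exp: "F y b = (\<Sum>i\<in>Basis. (b \<bullet> i) *\<^sub>R F y i)" if "y \<in> S" for y b
    by (rule linear_eq_sum_Basis[OF lin[OF that]])
  \<comment> \<open>Linearity of the derivative in \<open>b\<close> is not assumed: it is inherited
    from \<open>F\<close> by uniqueness of derivatives.\<close>
  have F': "F' h b = (\<Sum>i\<in>Basis. (b \<bullet> i) *\<^sub>R F' h i)" for h b
  proof -
    have "((\<lambda>y. \<Sum>i\<in>Basis. (b \<bullet> i) *\<^sub>R F y i) has_derivative
        (\<lambda>h. \<Sum>i\<in>Basis. (b \<bullet> i) *\<^sub>R F' h i)) (at x)"
      by (intro has_derivative_sum has_derivative_scaleR_right F)
    from has_derivative_transform_within_open[OF this S, of "\<lambda>y. F y b"] exp
    have "((\<lambda>y. F y b) has_derivative (\<lambda>h. \<Sum>i\<in>Basis. (b \<bullet> i) *\<^sub>R F' h i)) (at x)" by metis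
    from has_derivative_unique[OF F this] show ?thesis by metis
  qed
  have "((\<lambda>y. \<Sum>i\<in>Basis. (a y \<bullet> i) *\<^sub>R F y i) has_derivative
      (\<lambda>h. \<Sum>i\<in>Basis. (a x \<bullet> i) *\<^sub>R F' h i + (a' h \<bullet> i) *\<^sub>R F x i)) (at x)"
    by (intro has_derivative_sum has_derivative_scaleR has_derivative_inner_left F a)
  moreover have "(\<lambda>h. \<Sum>i\<in>Basis. (a x \<bullet> i) *\<^sub>R F' h i + (a' h \<bullet> i) *\<^sub>R F x i)
      = (\<lambda>h. F' h (a x) + F x (a' h))"
    by (simp add: sum.distrib F'[of _ "a x", symmetric] exp[OF S(2), symmetric])
  ultimately have "((\<lambda>y. \<Sum>i\<in>Basis. (a y \<bullet> i) *\<^sub>R F y i) has_derivative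
      (\<lambda>h. F' h (a x) + F x (a' h))) (at x)" by simp
  from has_derivative_transform_within_open[OF this S, of "\<lambda>y. F y (a y)"] exp
  show ?thesis by metis
qed

lemma has_derivative_bilinear_family:
  fixes W :: "'a::real_normed_vector \<Rightarrow> 'b::euclidean_space \<Rightarrow> 'c::euclidean_space \<Rightarrow> 'd::real_normed_vector"
  assumes S: "open S" "x \<in> S" and bil: "\<And>y. y \<in> S \<Longrightarrow> bilinear (W y)"
    and W: "\<And>b c. ((\<lambda>y. W y b c) has_derivative (\<lambda>h. W' h b c)) (at x)"
    and a: "(a has_derivative a') (at x)" and b: "(b has_derivative b') (at x)"
  shows "((\<lambda>y. W y (a y) (b y)) has_derivative
    (\<lambda>h. W' h (a x) (b x) + W x (a' h) (b x) + W x (a x) (b' h))) (at x)"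
proof -
  have 1: "((\<lambda>y. W y v (b y)) has_derivative (\<lambda>h. W' h v (b x) + W x v (b' h))) (at x)" for v
    by (rule has_derivative_linear_family[OF S _ W b]) (use bil in \<open>auto simp: bilinear_def\<close>)
  have "((\<lambda>y. W y (a y) (b y)) has_derivative
    (\<lambda>h. (W' h (a x) (b x) + W x (a x) (b' h)) + W x (a' h) (b x))) (at x)"
    by (rule has_derivative_linear_family[OF S _ 1 a]) (use bil in \<open>auto simp: bilinear_def\<close>)
  then show ?thesis by (simp add: algebra_simps)
qed

section \<open>Charts, coordinates and vector fields\<close>

text \<open>The Jacobian of a change of charts. Both \<open>tcoord\<close> and
  \<open>coord_field\<close> are instances with the chosen chart on one side, so they are mutually
  inverse by the cocycle rule \<open>transition_transition\<close>, which is the chain rule.\<close>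

definition transition :: "('m, 'e::euclidean_space) chart \<Rightarrow> ('m, 'e) chart \<Rightarrow> 'm \<Rightarrow> 'e \<Rightarrow> 'e" where
  "transition c c' p = frechet_derivative (cmap c' \<circ> cinv c) (at (cmap c p))"

lemma tcoord_transition: "tcoord A c p v = transition (chart_at A p) c p v"
  by (simp add: tcoord_def transition_def)

lemma coord_field_transition: "coord_field A c w q = transition c (chart_at A q) q w"
  by (simp add: coord_field_def transition_def)

lemma smooth_fun_const: "smooth_fun A U (\<lambda>q. r)"
  by (simp add: smooth_fun_def o_def smooth_on_const)

lemma smooth_field_subset: "smooth_field A U X \<Longrightarrow> V \<subseteq> U \<Longrightarrow> smooth_field A V X"
  unfolding smooth_field_def by (meson Int_mono image_mono order_refl smooth_on_subset)

locale smooth_manifold =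
  fixes A :: "('m::topological_space, 'e::euclidean_space) atlas"
  assumes atlas: "smooth_atlas A"
begin

lemma chart_at: "chart_at A p \<in> A" "p \<in> cdom (chart_at A p)"
proof -
  have "\<exists>c. c \<in> A \<and> p \<in> cdom c" using atlas unfolding smooth_atlas_def by blast
  then have "chart_at A p \<in> A \<and> p \<in> cdom (chart_at A p)" unfolding chart_at_def by (rule someI_ex)
  then show "chart_at A p \<in> A" "p \<in> cdom (chart_at A p)" by auto
qed

lemma chart_homeomorphism: "c \<in> A \<Longrightarrow> homeomorphism (cdom c) (cmap c ` cdom c) (cmap c) (cinv c)"
  using atlas by (simp add: smooth_atlas_def)

lemma open_cdom: "c \<in> A \<Longrightarrow> open (cdom c)"
  using atlas by (simp add: smooth_atlas_def)

lemma cinv_cmap: "c \<in> A \<Longrightarrow> q \<in> cdom c \<Longrightarrow> cinv c (cmap c q) = q"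
  using chart_homeomorphism by (auto simp: homeomorphism_def)

lemma open_chart_image:
  assumes "c \<in> A" and "open U"
  shows "open (cmap c ` (U \<inter> cdom c))"
proof -
  have "openin (top_of_set (cdom c)) (U \<inter> cdom c)" using assms by (metis Int_commute openin_open_Int)
  from homeomorphism_imp_open_map[OF chart_homeomorphism[OF assms(1)] this]
  have "openin (top_of_set (cmap c ` cdom c)) (cmap c ` (U \<inter> cdom c))" .
  moreover have "open (cmap c ` cdom c)" using assms atlas by (simp add: smooth_atlas_def)
  ultimately show ?thesis using openin_open_eq by blast
qed

lemma transition_smooth:
  "c \<in> A \<Longrightarrow> c' \<in> A \<Longrightarrow> smooth_on (cmap c ` (cdom c' \<inter> cdom c)) (cmap c' \<circ> cinv c)"
  using atlas by (simp add: smooth_atlas_def Int_commute)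

lemma transition_has_derivative:
  assumes "c \<in> A" "c' \<in> A" "p \<in> cdom c" "p \<in> cdom c'"
  shows "((cmap c' \<circ> cinv c) has_derivative transition c c' p) (at (cmap c p))"
  unfolding transition_def
  by (rule smooth_on_has_derivative[OF transition_smooth[OF assms(1,2)]]) (use assms in auto)

lemma transition_linear:
  assumes "c \<in> A" "c' \<in> A" "p \<in> cdom c" "p \<in> cdom c'"
  shows "linear (transition c c' p)"
  using transition_has_derivative[OF assms] has_derivative_linear by blast

lemma transition_transition:
  assumes "c \<in> A" "c' \<in> A" "c'' \<in> A" "p \<in> cdom c" "p \<in> cdom c'" "p \<in> cdom c''"
  shows "transition c' c'' p (transition c c' p v) = transition c c'' p v"
proof -
  have "((cmap c'' \<circ> cinv c') has_derivative transition c' c'' p) (at ((cmap c' \<circ> cinv c) (cmap c p)))"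
    using assms transition_has_derivative by (simp add: cinv_cmap)
  from diff_chain_at[OF transition_has_derivative[of c c' p] this]
  have "((cmap c'' \<circ> cinv c') \<circ> (cmap c' \<circ> cinv c) has_derivative
      transition c' c'' p \<circ> transition c c' p) (at (cmap c p))"
    using assms by blast
  then have "((cmap c'' \<circ> cinv c) has_derivative transition c' c'' p \<circ> transition c c' p) (at (cmap c p))"
    by (rule has_derivative_transform_within_open[OF _ open_chart_image[of c "cdom c'"]])
       (use assms in \<open>auto simp: open_cdom cinv_cmap\<close>)
  from frechet_derivative_eq[OF this] show ?thesis by (simp add: transition_def)
qed

lemma transition_self:
  assumes "c \<in> A" "p \<in> cdom c"
  shows "transition c c p v = v"
proof -
  have "((\<lambda>y. y) has_derivative (\<lambda>v. v)) (at (cmap c p))" by simp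
  then have "((cmap c \<circ> cinv c) has_derivative (\<lambda>v. v)) (at (cmap c p))"
    by (rule has_derivative_transform_within_open[OF _ open_chart_image[of c UNIV]])
       (use assms in \<open>auto simp: cinv_cmap\<close>)
  from frechet_derivative_eq[OF this] show ?thesis by (simp add: transition_def)
qed

lemma tcoord_coord_field:
  "c \<in> A \<Longrightarrow> c' \<in> A \<Longrightarrow> q \<in> cdom c \<Longrightarrow> q \<in> cdom c' \<Longrightarrow>
    tcoord A c q (coord_field A c' w q) = transition c' c q w"
  by (simp add: tcoord_transition coord_field_transition transition_transition chart_at)

lemma tcoord_coord_field_self: "c \<in> A \<Longrightarrow> q \<in> cdom c \<Longrightarrow> tcoord A c q (coord_field A c w q) = w"
  by (simp add: tcoord_coord_field transition_self)

lemma coord_field_tcoord: "c \<in> A \<Longrightarrow> q \<in> cdom c \<Longrightarrow> coord_field A c (tcoord A c q v) q = v"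
  by (simp add: tcoord_transition coord_field_transition transition_transition chart_at transition_self)

lemma tcoord_chart_at: "tcoord A (chart_at A p) p v = v"
  by (simp add: tcoord_transition transition_self chart_at)

lemma coord_field_chart_at: "coord_field A (chart_at A p) w p = w"
  by (simp add: coord_field_transition transition_self chart_at)

lemma ext_same: "ext A p w p = w"
  by (simp add: ext_def coord_field_chart_at)

lemma linear_tcoord: "c \<in> A \<Longrightarrow> q \<in> cdom c \<Longrightarrow> linear (tcoord A c q)"
  using transition_linear[of "chart_at A q" c q] by (simp add: tcoord_transition[abs_def] chart_at)

lemma linear_coord_field: "c \<in> A \<Longrightarrow> q \<in> cdom c \<Longrightarrow> linear (\<lambda>w. coord_field A c w q)"
  using transition_linear[of c "chart_at A q" q] by (simp add: coord_field_transition chart_at)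

text \<open>\<open>smooth_fun\<close> quantifies over all charts of the atlas; smooth transition
  maps reduce this to the one chart in which the function is given.\<close>

lemma smooth_fun_chart:
  assumes c: "c \<in> A" and U: "open U" and G: "smooth_on (cmap c ` (U \<inter> cdom c)) G"
  shows "smooth_fun A (U \<inter> cdom c) (G \<circ> cmap c)"
  unfolding smooth_fun_def
proof
  fix c' assume c': "c' \<in> A"
  have "smooth_on (cmap c' ` (U \<inter> cdom c \<inter> cdom c')) (G \<circ> (cmap c \<circ> cinv c'))"
  proof (rule smooth_on_compose[OF G])
    show "smooth_on (cmap c' ` (U \<inter> cdom c \<inter> cdom c')) (cmap c \<circ> cinv c')"
      by (rule smooth_on_subset[OF transition_smooth[OF c' c]]) auto
    show "open (cmap c' ` (U \<inter> cdom c \<inter> cdom c'))" "open (cmap c ` (U \<inter> cdom c))"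
      using U c c' by (auto intro!: open_chart_image open_cdom)
    show "(cmap c \<circ> cinv c') ` cmap c' ` (U \<inter> cdom c \<inter> cdom c') \<subseteq> cmap c ` (U \<inter> cdom c)"
      using c' by (auto simp: cinv_cmap)
  qed
  then show "smooth_on (cmap c' ` (U \<inter> cdom c \<inter> cdom c')) (G \<circ> cmap c \<circ> cinv c')"
    by (simp add: comp_assoc)
qed

text \<open>In another chart the constant components become a column of the Jacobian of the
  transition map, evaluated at a moving point; this is a derivative of a smooth map composed with a
  smooth map.\<close>

lemma smooth_field_coord_field:
  assumes c: "c \<in> A"
  shows "smooth_field A (cdom c) (coord_field A c w)"
  unfolding smooth_field_def
proof
  fix c' assume c': "c' \<in> A"
  let ?O = "cmap c' ` (cdom c \<inter> cdom c')" and ?G = "\<lambda>z. frechet_derivative (cmap c' \<circ> cinv c) (at z) w"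
  have op: "open ?O" using c c' by (intro open_chart_image open_cdom)
  have "smooth_on ?O (?G \<circ> (cmap c \<circ> cinv c'))"
  proof (rule smooth_on_compose)
    show "smooth_on (cmap c ` (cdom c' \<inter> cdom c)) ?G"
      by (rule smooth_on_frechet_derivative[OF transition_smooth[OF c c']])
    show "smooth_on ?O (cmap c \<circ> cinv c')" by (rule transition_smooth[OF c' c])
    show "open ?O" "open (cmap c ` (cdom c' \<inter> cdom c))"
      using c c' by (auto intro!: open_chart_image open_cdom)
    show "(cmap c \<circ> cinv c') ` ?O \<subseteq> cmap c ` (cdom c' \<inter> cdom c)"
      using c' by (auto simp: cinv_cmap)
  qed
  then show "smooth_on ?O (field_rep A c' (coord_field A c w))"
    by (rule smooth_on_cong[OF _ op])
       (use c c' in \<open>auto simp: field_rep_def cinv_cmap tcoord_coord_field transition_def\<close>)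
qed

lemma smooth_field_ext: "U \<subseteq> cdom (chart_at A p) \<Longrightarrow> smooth_field A U (ext A p w)"
  unfolding ext_def using smooth_field_coord_field[OF chart_at(1)] smooth_field_subset by blast

lemma smooth_field_add:
  assumes "smooth_field A U X" and "smooth_field A U Y" and "open U"
  shows "smooth_field A U (\<lambda>q. X q + Y q)"
  unfolding smooth_field_def
proof
  fix c assume c: "c \<in> A"
  note op = open_chart_image[OF c assms(3)]
  have "smooth_on (cmap c ` (U \<inter> cdom c)) (\<lambda>y. field_rep A c X y + field_rep A c Y y)"
    using assms c op by (auto intro!: smooth_on_add simp: smooth_field_def)
  then show "smooth_on (cmap c ` (U \<inter> cdom c)) (field_rep A c (\<lambda>q. X q + Y q))"
    by (rule smooth_on_cong[OF _ op])
       (use c in \<open>auto simp: field_rep_def cinv_cmap linear_add[OF linear_tcoord]\<close>)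
qed

lemma smooth_field_scaleR:
  assumes "smooth_fun A U f" and "smooth_field A U Y" and "open U"
  shows "smooth_field A U (\<lambda>q. f q *\<^sub>R Y q)"
  unfolding smooth_field_def
proof
  fix c assume c: "c \<in> A"
  note op = open_chart_image[OF c assms(3)]
  have "smooth_on (cmap c ` (U \<inter> cdom c)) (f \<circ> cinv c)"
    and "smooth_on (cmap c ` (U \<inter> cdom c)) (field_rep A c Y)"
    using assms c by (auto simp: smooth_field_def smooth_fun_def simp del: o_apply)
  from smooth_on_scaleR[OF this op]
  have "smooth_on (cmap c ` (U \<inter> cdom c)) (\<lambda>y. (f \<circ> cinv c) y *\<^sub>R field_rep A c Y y)" .
  then show "smooth_on (cmap c ` (U \<inter> cdom c)) (field_rep A c (\<lambda>q. f q *\<^sub>R Y q))"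
    by (rule smooth_on_cong[OF _ op])
       (use c in \<open>auto simp: field_rep_def cinv_cmap linear_cmul[OF linear_tcoord]\<close>)
qed

lemma smooth_field_zero:
  assumes "open U"
  shows "smooth_field A U (\<lambda>q. 0)"
  unfolding smooth_field_def
proof
  fix c assume c: "c \<in> A"
  show "smooth_on (cmap c ` (U \<inter> cdom c)) (field_rep A c (\<lambda>q. 0))"
    by (rule smooth_on_cong[OF smooth_on_const[of _ 0] open_chart_image[OF c assms]])
       (use c in \<open>auto simp: field_rep_def cinv_cmap linear_0[OF linear_tcoord[OF c]]\<close>)
qed

lemma field_rep_has_derivative:
  assumes "smooth_field A U X" and "p \<in> U" and "c \<in> A" and "p \<in> cdom c"
  shows "(field_rep A c X has_derivative frechet_derivative (field_rep A c X) (at (cmap c p)))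
    (at (cmap c p))"
  by (rule smooth_on_has_derivative[of "cmap c ` (U \<inter> cdom c)"]) (use assms in \<open>auto simp: smooth_field_def\<close>)

lemma dfun_has_derivative:
  assumes "smooth_fun A U f" and "p \<in> U"
  shows "(f \<circ> cinv (chart_at A p) has_derivative dfun A f p) (at (cmap (chart_at A p) p))"
  using smooth_on_has_derivative[of "cmap (chart_at A p) ` (U \<inter> cdom (chart_at A p))" "f \<circ> cinv (chart_at A p)"
      "cmap (chart_at A p) p"] assms chart_at[of p]
  by (auto simp: dfun_def[abs_def] smooth_fun_def)

end

text \<open>
  \<open>dEnd\<close>, \<open>dform\<close> and \<open>christoffel\<close> are not tensors: they refer to the chart chosen at \<open>p\<close>.
\<close>

definition dEnd :: "('m, 'e::euclidean_space) atlas \<Rightarrow> ('m \<Rightarrow> 'e \<Rightarrow> 'e) \<Rightarrow> 'm \<Rightarrow> 'e \<Rightarrow> 'e \<Rightarrow> 'e" where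
  "dEnd A J p u v = frechet_derivative (field_rep A (chart_at A p) (\<lambda>q. J q (ext A p v q)))
     (at (cmap (chart_at A p) p)) u"

definition dform :: "('m, 'e::euclidean_space) atlas \<Rightarrow> ('m \<Rightarrow> 'e \<Rightarrow> 'e \<Rightarrow> real) \<Rightarrow>
    'm \<Rightarrow> 'e \<Rightarrow> 'e \<Rightarrow> 'e \<Rightarrow> real" where
  "dform A \<omega> p u v w = dfun A (\<lambda>q. \<omega> q (ext A p v q) (ext A p w q)) p u"

definition nijenhuis_at :: "('m, 'e::euclidean_space) atlas \<Rightarrow> ('m \<Rightarrow> 'e \<Rightarrow> 'e) \<Rightarrow> 'm \<Rightarrow> 'e \<Rightarrow> 'e \<Rightarrow> 'e" where
  "nijenhuis_at A J p u v =
     dEnd A J p (J p u) v - dEnd A J p (J p v) u + J p (dEnd A J p v u) - J p (dEnd A J p u v)"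

definition christoffel :: "('m, 'e::euclidean_space) atlas \<Rightarrow> ('m, 'e) conn \<Rightarrow> 'm \<Rightarrow> 'e \<Rightarrow> 'e \<Rightarrow> 'e" where
  "christoffel A D p u v = D (ext A p v) p u"

lemma smooth_End_subset: "smooth_End A U J \<Longrightarrow> V \<subseteq> U \<Longrightarrow> smooth_End A V J"
  unfolding smooth_End_def by (meson Int_mono order_refl smooth_field_subset subsetD)

section \<open>Endomorphism fields and the Nijenhuis tensor in the chart at a point\<close>

context smooth_manifold
begin

lemma chart_at_open: "open (cdom (chart_at A p))"
  by (rule open_cdom[OF chart_at(1)])

lemma chart_nbhd:
  assumes "open U" "p \<in> U"
  shows "open (cmap (chart_at A p) ` (U \<inter> cdom (chart_at A p)))"
    and "cmap (chart_at A p) p \<in> cmap (chart_at A p) ` (U \<inter> cdom (chart_at A p))"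
  using assms chart_at[of p] by (auto intro!: open_chart_image)

lemma cinv_chart_at: "cinv (chart_at A p) (cmap (chart_at A p) p) = p"
  by (simp add: cinv_cmap chart_at)

lemma ext_field_rep:
  assumes "q \<in> cdom (chart_at A p)"
  shows "ext A p (field_rep A (chart_at A p) X (cmap (chart_at A p) q)) q = X q"
  using assms by (simp add: ext_def field_rep_def cinv_cmap coord_field_tcoord chart_at)

lemma field_rep_chart_at: "field_rep A (chart_at A p) X (cmap (chart_at A p) p) = X p"
  by (simp add: field_rep_def cinv_cmap chart_at tcoord_chart_at)

lemma linear_ext: "q \<in> cdom (chart_at A p) \<Longrightarrow> linear (\<lambda>v. ext A p v q)"
  unfolding ext_def by (rule linear_coord_field[OF chart_at(1)])

lemma linear_End_rep:
  assumes "q \<in> cdom (chart_at A p)" and "linear (J q)"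
  shows "linear (\<lambda>v. field_rep A (chart_at A p) (\<lambda>q. J q (ext A p v q)) (cmap (chart_at A p) q))"
  using linear_compose[OF linear_compose[OF linear_ext[OF assms(1)] assms(2)]
      linear_tcoord[OF chart_at(1) assms(1)]] assms(1)
  by (simp add: field_rep_def cinv_cmap chart_at o_def)

lemma dEnd_has_derivative:
  assumes "smooth_End A U J" and "p \<in> U"
  shows "(field_rep A (chart_at A p) (\<lambda>q. J q (ext A p v q)) has_derivative (\<lambda>u. dEnd A J p u v))
    (at (cmap (chart_at A p) p))"
  unfolding dEnd_def
  by (rule field_rep_has_derivative[of "U \<inter> cdom (chart_at A p)"])
     (use assms chart_at[of p] in \<open>auto simp: smooth_End_def ext_def\<close>)

lemma linear_dEnd1: "smooth_End A U J \<Longrightarrow> p \<in> U \<Longrightarrow> linear (\<lambda>u. dEnd A J p u v)"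
  using dEnd_has_derivative has_derivative_linear by blast

text \<open>The components of \<open>J\<close> applied to \<open>X\<close> are the matrix of
  \<open>J\<close> in the chart at \<open>p\<close>, which varies with the point, applied to the
  varying components of \<open>X\<close>; the product rule for linear families separates the two
  variations.\<close>

lemma End_field_has_derivative:
  assumes J: "smooth_End A U J" and U: "open U" "p \<in> U" and X: "smooth_field A U X"
  shows "(field_rep A (chart_at A p) (\<lambda>q. J q (X q)) has_derivative
    (\<lambda>u. dEnd A J p u (X p) + J p (frechet_derivative (field_rep A (chart_at A p) X)
       (at (cmap (chart_at A p) p)) u))) (at (cmap (chart_at A p) p))"
proof -
  let ?c = "chart_at A p" and ?z = "cmap (chart_at A p) p"
  let ?F = "\<lambda>y v. field_rep A ?c (\<lambda>q. J q (ext A p v q)) y"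
  note nb = chart_nbhd[OF U]
  have "((\<lambda>y. ?F y (field_rep A ?c X y)) has_derivative
     (\<lambda>u. dEnd A J p u (field_rep A ?c X ?z) + ?F ?z (frechet_derivative (field_rep A ?c X) (at ?z) u))) (at ?z)"
  proof (rule has_derivative_linear_family[OF nb, where F = ?F])
    show "linear (?F y)" if "y \<in> cmap ?c ` (U \<inter> cdom ?c)" for y
      using that J linear_End_rep by (auto simp: smooth_End_def)
    show "((\<lambda>y. ?F y v) has_derivative (\<lambda>u. dEnd A J p u v)) (at ?z)" for v
      by (rule dEnd_has_derivative[OF J U(2)])
  qed (rule field_rep_has_derivative[OF X U(2) chart_at])
  moreover have "?F y (field_rep A ?c X y) = field_rep A ?c (\<lambda>q. J q (X q)) y"
    if "y \<in> cmap ?c ` (U \<inter> cdom ?c)" for y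
    using that ext_field_rep[of _ p X] by (auto simp: field_rep_def cinv_cmap chart_at)
  ultimately have "(field_rep A ?c (\<lambda>q. J q (X q)) has_derivative
     (\<lambda>u. dEnd A J p u (field_rep A ?c X ?z) + ?F ?z (frechet_derivative (field_rep A ?c X) (at ?z) u))) (at ?z)"
    by (rule has_derivative_transform_within_open[OF _ nb])
  then show ?thesis by (simp add: field_rep_chart_at ext_same)
qed

text \<open>Derivative of \<open>J\<close> composed with itself: on a field with constant components
  \<open>v\<close> this composite has the constant components \<open>- v\<close>.\<close>

lemma dEnd_involution:
  assumes J: "smooth_End A U J" and U: "open U" "p \<in> U"
    and sq: "\<And>q v. q \<in> U \<Longrightarrow> J q (J q v) = - v"
  shows "dEnd A J p u (J p v) + J p (dEnd A J p u v) = 0"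
proof -
  let ?c = "chart_at A p" and ?z = "cmap (chart_at A p) p" and ?U = "U \<inter> cdom (chart_at A p)"
  have U': "open ?U" "p \<in> ?U" using U chart_at(2)[of p] by (auto intro!: open_Int chart_at_open)
  have J': "smooth_End A ?U J" by (rule smooth_End_subset[OF J]) auto
  have JX: "smooth_field A ?U (\<lambda>q. J q (ext A p v q))"
    using J chart_at(1)[of p] by (auto simp: smooth_End_def ext_def)
  have "(field_rep A ?c (\<lambda>q. J q (J q (ext A p v q))) has_derivative
    (\<lambda>u. dEnd A J p u (J p v) + J p (dEnd A J p u v))) (at ?z)"
    using End_field_has_derivative[OF J' U' JX] by (simp add: ext_same dEnd_def)
  then have "((\<lambda>y. - v) has_derivative (\<lambda>u. dEnd A J p u (J p v) + J p (dEnd A J p u v))) (at ?z)"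
    by (rule has_derivative_transform_within_open[OF _ chart_nbhd[OF U']])
       (use sq in \<open>auto simp: field_rep_def cinv_cmap chart_at ext_def tcoord_coord_field_self
         linear_neg[OF linear_tcoord]\<close>)
  from has_derivative_unique[OF this has_derivative_const] show ?thesis by metis
qed

text \<open>After the product rule every derivative of \<open>X\<close> and \<open>Y\<close> occurs
  twice with opposite signs, because the square of \<open>J\<close> is minus the identity. Only
  derivatives of \<open>J\<close> survive, so the value depends on \<open>X p\<close> and
  \<open>Y p\<close> alone.\<close>

lemma nijenhuis_eq:
  assumes J: "smooth_End A U J" and U: "open U" "p \<in> U"
    and X: "smooth_field A U X" and Y: "smooth_field A U Y"
    and sq: "\<And>v. J p (J p v) = - v"
  shows "nijenhuis A J X Y p = nijenhuis_at A J p (X p) (Y p)"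
proof -
  have lin: "linear (J p)" using J U by (auto simp: smooth_End_def)
  show ?thesis
    unfolding nijenhuis_def lie_bracket_def Let_def nijenhuis_at_def
    by (simp add: frechet_derivative_eq[OF End_field_has_derivative[OF J U X]]
        frechet_derivative_eq[OF End_field_has_derivative[OF J U Y]]
        linear_add[OF lin] linear_diff[OF lin] sq algebra_simps)
qed

text \<open>Since the Nijenhuis expression is pointwise in its fields, testing it on the coordinate
  extensions of tangent vectors decides it for all local fields.\<close>

lemma integrable_acs_iff:
  assumes "almost_complex A J"
  shows "integrable_acs A J \<longleftrightarrow> (\<forall>p u v. nijenhuis_at A J p u v = 0)"
proof
  assume int: "integrable_acs A J"
  show "\<forall>p u v. nijenhuis_at A J p u v = 0"
  proof (intro allI)
    fix p u v
    let ?U = "cdom (chart_at A p)"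
    have U: "open ?U" "p \<in> ?U" by (rule chart_at_open, rule chart_at)
    have J: "smooth_End A ?U J"
      using assms smooth_End_subset[of A UNIV J] by (auto simp: almost_complex_def)
    have "nijenhuis A J (ext A p u) (ext A p v) p = nijenhuis_at A J p (ext A p u p) (ext A p v p)"
      using assms by (intro nijenhuis_eq[OF J U] smooth_field_ext) (auto simp: almost_complex_def)
    moreover have "nijenhuis A J (ext A p u) (ext A p v) p = 0"
      using int U smooth_field_ext[of ?U p] unfolding integrable_acs_def by blast
    ultimately show "nijenhuis_at A J p u v = 0" by (simp add: ext_same)
  qed
next
  assume N: "\<forall>p u v. nijenhuis_at A J p u v = 0"
  show "integrable_acs A J"
    unfolding integrable_acs_def
  proof (intro allI impI ballI)
    fix U X Y p assume UXY: "open U \<and> smooth_field A U X \<and> smooth_field A U Y" and p: "p \<in> U"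
    have J: "smooth_End A U J"
      using assms smooth_End_subset[of A UNIV J] by (auto simp: almost_complex_def)
    show "nijenhuis A J X Y p = 0"
      using nijenhuis_eq[OF J _ p, of X Y] UXY N assms by (simp add: almost_complex_def)
  qed
qed

section \<open>Two-forms in the chart at a point\<close>

lemma dform_has_derivative:
  assumes "two_form A \<omega>"
  shows "((\<lambda>y. \<omega> (cinv (chart_at A p) y) (ext A p v (cinv (chart_at A p) y))
      (ext A p w (cinv (chart_at A p) y))) has_derivative (\<lambda>u. dform A \<omega> p u v w))
    (at (cmap (chart_at A p) p))"
proof -
  have "smooth_fun A (cdom (chart_at A p)) (\<lambda>q. \<omega> q (ext A p v q) (ext A p w q))"
    using assms chart_at(1) unfolding two_form_def ext_def by blast
  from dfun_has_derivative[OF this chart_at(2)] show ?thesis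
    by (simp add: dform_def[abs_def] o_def)
qed

lemma linear_dform1: "two_form A \<omega> \<Longrightarrow> linear (\<lambda>u. dform A \<omega> p u v w)"
  using dform_has_derivative has_derivative_linear by blast

lemma bilinear_form_rep:
  assumes \<omega>: "two_form A \<omega>" and q: "q \<in> cdom (chart_at A p)"
  shows "bilinear (\<lambda>v w. \<omega> q (ext A p v q) (ext A p w q))"
proof -
  have 1: "bilinear (\<omega> q)" using \<omega> by (simp add: two_form_def)
  show ?thesis
    using linear_compose[OF linear_ext[OF q], of "\<omega> q x" for x]
      linear_compose[OF linear_ext[OF q], of "\<lambda>v. \<omega> q v x" for x] 1
    by (simp add: bilinear_def o_def)
qed

lemma form_rep_has_derivative:
  assumes \<omega>: "two_form A \<omega>"
    and a: "(a has_derivative a') (at (cmap (chart_at A p) p))"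
    and b: "(b has_derivative b') (at (cmap (chart_at A p) p))"
  shows "((\<lambda>y. \<omega> (cinv (chart_at A p) y) (ext A p (a y) (cinv (chart_at A p) y))
      (ext A p (b y) (cinv (chart_at A p) y))) has_derivative
    (\<lambda>u. dform A \<omega> p u (a (cmap (chart_at A p) p)) (b (cmap (chart_at A p) p))
       + \<omega> p (a' u) (b (cmap (chart_at A p) p)) + \<omega> p (a (cmap (chart_at A p) p)) (b' u)))
    (at (cmap (chart_at A p) p))"
proof -
  let ?c = "chart_at A p"
  have "bilinear (\<lambda>v w. \<omega> (cinv ?c y) (ext A p v (cinv ?c y)) (ext A p w (cinv ?c y)))"
    if "y \<in> cmap ?c ` (UNIV \<inter> cdom ?c)" for y
    using that bilinear_form_rep[OF \<omega>] by (auto simp: cinv_cmap chart_at)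
  from has_derivative_bilinear_family[OF chart_nbhd[OF open_UNIV UNIV_I, of p] this
      dform_has_derivative[OF \<omega>] a b]
  show ?thesis by (simp add: cinv_chart_at ext_same)
qed

text \<open>\<open>dform\<close> is a derivative of the components of the form, and those are
  bilinear at every nearby point; uniqueness of derivatives transfers each identity.\<close>

lemma dform_linear2:
  assumes \<omega>: "two_form A \<omega>"
  shows "linear (\<lambda>v. dform A \<omega> p u v w)" "linear (\<lambda>w. dform A \<omega> p u v w)"
proof -
  let ?c = "chart_at A p" and ?z = "cmap (chart_at A p) p"
  let ?W = "\<lambda>y v w. \<omega> (cinv ?c y) (ext A p v (cinv ?c y)) (ext A p w (cinv ?c y))"
  note nb = chart_nbhd[OF open_UNIV UNIV_I, of p]
  have bil: "bilinear (?W y)" if "y \<in> cmap ?c ` (UNIV \<inter> cdom ?c)" for y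
    using that bilinear_form_rep[OF \<omega>] by (auto simp: cinv_cmap chart_at)
  have W: "((\<lambda>y. ?W y v w) has_derivative (\<lambda>u. dform A \<omega> p u v w)) (at ?z)" for v w
    by (rule dform_has_derivative[OF \<omega>])
  have eqI: "dform A \<omega> p u v w = f' u"
    if "(f has_derivative f') (at ?z)" "\<And>y. y \<in> cmap ?c ` (UNIV \<inter> cdom ?c) \<Longrightarrow> f y = ?W y v w" for f f' v w
    using has_derivative_unique[OF W has_derivative_transform_within_open[OF that(1) nb that(2)]] by metis
  show "linear (\<lambda>v. dform A \<omega> p u v w)"
  proof (rule linearI)
    show "dform A \<omega> p u (v1 + v2) w = dform A \<omega> p u v1 w + dform A \<omega> p u v2 w" for v1 v2
      by (rule eqI[OF has_derivative_add[OF W W]]) (simp add: bilinear_ladd[OF bil])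
    show "dform A \<omega> p u (r *\<^sub>R v) w = r *\<^sub>R dform A \<omega> p u v w" for r v
      by (rule eqI[OF has_derivative_scaleR_right[OF W]]) (simp add: bilinear_lmul[OF bil])
  qed
  show "linear (\<lambda>w. dform A \<omega> p u v w)"
  proof (rule linearI)
    show "dform A \<omega> p u v (w1 + w2) = dform A \<omega> p u v w1 + dform A \<omega> p u v w2" for w1 w2
      by (rule eqI[OF has_derivative_add[OF W W]]) (simp add: bilinear_radd[OF bil])
    show "dform A \<omega> p u v (r *\<^sub>R w) = r *\<^sub>R dform A \<omega> p u v w" for r w
      by (rule eqI[OF has_derivative_scaleR_right[OF W]]) (simp add: bilinear_rmul[OF bil])
  qed
qed

lemma dform_skew:
  assumes "two_form A \<omega>"
  shows "dform A \<omega> p u v w = - dform A \<omega> p u w v"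
proof -
  have skew: "- \<omega> q b a = \<omega> q a b" for q a b
    using assms unfolding two_form_def by (metis minus_minus)
  have "((\<lambda>y. \<omega> (cinv (chart_at A p) y) (ext A p v (cinv (chart_at A p) y))
      (ext A p w (cinv (chart_at A p) y))) has_derivative (\<lambda>u. - dform A \<omega> p u w v))
    (at (cmap (chart_at A p) p))"
    using has_derivative_minus[OF dform_has_derivative[OF assms, where v = w and w = v]]
    by (simp add: skew)
  from has_derivative_unique[OF dform_has_derivative[OF assms] this] show ?thesis by metis
qed

text \<open>The identity \<open>herm\<close> differentiated along fields with constant components,
  with the product rule for bilinear families on its left side.\<close>

lemma dform_hermitian:
  assumes \<omega>: "two_form A \<omega>" and J: "smooth_End A U J" and U: "open U" "p \<in> U"
    and herm: "\<And>q v w. q \<in> U \<Longrightarrow> \<omega> q (J q v) (J q w) = \<omega> q v w"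
  shows "dform A \<omega> p u (J p v) (J p w) + \<omega> p (dEnd A J p u v) (J p w) + \<omega> p (J p v) (dEnd A J p u w)
    = dform A \<omega> p u v w"
proof -
  let ?c = "chart_at A p"
  let ?F = "\<lambda>y v. field_rep A ?c (\<lambda>q. J q (ext A p v q)) y"
  have "((\<lambda>y. \<omega> (cinv ?c y) (ext A p (?F y v) (cinv ?c y)) (ext A p (?F y w) (cinv ?c y)))
    has_derivative (\<lambda>u. dform A \<omega> p u (J p v) (J p w) + \<omega> p (dEnd A J p u v) (J p w)
       + \<omega> p (J p v) (dEnd A J p u w))) (at (cmap ?c p))"
    using form_rep_has_derivative[OF \<omega> dEnd_has_derivative[OF J U(2), of v] dEnd_has_derivative[OF J U(2), of w]]
    by (simp add: field_rep_chart_at ext_same)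
  then have "((\<lambda>y. \<omega> (cinv ?c y) (ext A p v (cinv ?c y)) (ext A p w (cinv ?c y)))
    has_derivative (\<lambda>u. dform A \<omega> p u (J p v) (J p w) + \<omega> p (dEnd A J p u v) (J p w)
       + \<omega> p (J p v) (dEnd A J p u w))) (at (cmap ?c p))"
    by (rule has_derivative_transform_within_open[OF _ chart_nbhd[OF U]])
       (use herm in \<open>auto simp: ext_field_rep cinv_cmap chart_at\<close>)
  from has_derivative_unique[OF this dform_has_derivative[OF \<omega>]] show ?thesis by metis
qed

end

section \<open>Connections in coordinates\<close>

locale manifold_connection = smooth_manifold A
  for A :: "('m::topological_space, 'e::euclidean_space) atlas" +
  fixes D :: "('m, 'e) conn"
  assumes connection: "connection_on A UNIV D"
begin

lemma D_linear: "open U \<Longrightarrow> smooth_field A U Y \<Longrightarrow> p \<in> U \<Longrightarrow> linear (D Y p)"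
  using connection unfolding connection_on_def by (meson subset_UNIV)

lemma D_cong:
  "open U \<Longrightarrow> smooth_field A U X \<Longrightarrow> smooth_field A U Y \<Longrightarrow> p \<in> U \<Longrightarrow>
    (\<And>q. q \<in> U \<Longrightarrow> X q = Y q) \<Longrightarrow> D X p = D Y p"
  using connection unfolding connection_on_def by (meson subset_UNIV)

lemma D_add:
  "open U \<Longrightarrow> smooth_field A U X \<Longrightarrow> smooth_field A U Y \<Longrightarrow> p \<in> U \<Longrightarrow>
    D (\<lambda>q. X q + Y q) p v = D X p v + D Y p v"
  using connection unfolding connection_on_def by (meson subset_UNIV)

lemma D_scaleR:
  "open U \<Longrightarrow> smooth_field A U Y \<Longrightarrow> smooth_fun A U f \<Longrightarrow> p \<in> U \<Longrightarrow>
    D (\<lambda>q. f q *\<^sub>R Y q) p v = dfun A f p v *\<^sub>R Y p + f p *\<^sub>R D Y p v"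
  using connection unfolding connection_on_def by (meson subset_UNIV)

lemma dfun_const: "dfun A (\<lambda>q. r) p v = 0"
  by (simp add: dfun_def o_def)

lemma bilinear_christoffel: "bilinear (christoffel A D p)"
proof -
  let ?U = "cdom (chart_at A p)"
  note U = chart_at_open[of p] chart_at(2)[of p]
  note sm = smooth_field_ext[OF subset_refl, of p]
  have "christoffel A D p u (v + w) = christoffel A D p u v + christoffel A D p u w" for u v w
  proof -
    have "D (ext A p (v + w)) p = D (\<lambda>q. ext A p v q + ext A p w q) p"
      by (rule D_cong[OF U(1) sm smooth_field_add[OF sm sm U(1)] U(2)]) (simp add: linear_add[OF linear_ext])
    then show ?thesis by (simp add: christoffel_def D_add[OF U(1) sm sm U(2)])
  qed
  moreover have "christoffel A D p u (r *\<^sub>R v) = r *\<^sub>R christoffel A D p u v" for u r v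
  proof -
    have "D (ext A p (r *\<^sub>R v)) p = D (\<lambda>q. r *\<^sub>R ext A p v q) p"
      by (rule D_cong[OF U(1) sm smooth_field_scaleR[OF smooth_fun_const sm U(1)] U(2)])
         (simp add: linear_cmul[OF linear_ext])
    then show ?thesis
      by (simp add: christoffel_def D_scaleR[OF U(1) sm smooth_fun_const U(2)] dfun_const)
  qed
  ultimately have "linear (christoffel A D p u)" for u by (intro linearI)
  moreover have "linear (\<lambda>u. christoffel A D p u v)" for v
    using D_linear[OF U(1) sm U(2)] by (simp add: christoffel_def)
  ultimately show ?thesis by (simp add: bilinear_def)
qed

lemma D_sum:
  assumes U: "open U" "p \<in> U" and X: "\<And>i. i \<in> I \<Longrightarrow> smooth_field A U (X i)" and I: "finite I"
  shows "smooth_field A U (\<lambda>q. \<Sum>i\<in>I. X i q) \<and> D (\<lambda>q. \<Sum>i\<in>I. X i q) p v = (\<Sum>i\<in>I. D (X i) p v)"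
  using I X
proof (induction I rule: finite_induct)
  case empty
  have z: "smooth_field A U (\<lambda>q. 0)" by (rule smooth_field_zero[OF U(1)])
  \<comment> \<open>The value on the zero field comes from additivity: it equals its own
    double.\<close>
  have "D (\<lambda>q. 0) p v = D (\<lambda>q. 0 + 0) p v" by simp
  also have "\<dots> = D (\<lambda>q. 0) p v + D (\<lambda>q. 0) p v" by (rule D_add[OF U(1) z z U(2)])
  finally show ?case using z by simp
next
  case (insert i I)
  then show ?case using U by (auto simp: smooth_field_add D_add)
qed

text \<open>A connection is given here only as an operator on local fields. Writing \<open>Y\<close>
  near \<open>p\<close> as a sum of component functions times coordinate fields and using additivity
  and the Leibniz rule gives the classical form: partial derivative plus Christoffel term.\<close>

lemma D_coordinates:
  assumes U: "open U" "p \<in> U" and Y: "smooth_field A U Y"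
  shows "D Y p u = frechet_derivative (field_rep A (chart_at A p) Y) (at (cmap (chart_at A p) p)) u
    + christoffel A D p u (Y p)"
proof -
  let ?c = "chart_at A p" and ?z = "cmap (chart_at A p) p" and ?V = "U \<inter> cdom (chart_at A p)"
  let ?Y' = "frechet_derivative (field_rep A ?c Y) (at ?z)"
  define f where "f i q = field_rep A ?c Y (cmap ?c q) \<bullet> i" for i q
  have V: "open ?V" "p \<in> ?V" using U chart_at(2)[of p] by (auto intro!: open_Int chart_at_open)
  have YV: "smooth_field A ?V Y" using Y smooth_field_subset by blast
  have f: "smooth_fun A ?V (f i)" for i
  proof -
    have "smooth_on (cmap ?c ` ?V) (\<lambda>y. field_rep A ?c Y y \<bullet> i)"
      using Y chart_at(1) open_chart_image[OF chart_at(1) U(1)]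
      by (intro smooth_on_linear[OF bounded_linear_inner_left]) (auto simp: smooth_field_def)
    from smooth_fun_chart[OF chart_at(1) U(1) this] show ?thesis
      by (simp add: f_def[abs_def] o_def)
  qed
  have fE: "smooth_field A ?V (\<lambda>q. f i q *\<^sub>R ext A p i q)" for i
    by (intro smooth_field_scaleR f smooth_field_ext V) auto
  have df: "dfun A (f i) p u = ?Y' u \<bullet> i" for i
  proof -
    have "((\<lambda>y. field_rep A ?c Y y \<bullet> i) has_derivative (\<lambda>u. ?Y' u \<bullet> i)) (at ?z)"
      by (intro has_derivative_inner_left field_rep_has_derivative[OF Y U(2) chart_at])
    then have "(f i \<circ> cinv ?c has_derivative (\<lambda>u. ?Y' u \<bullet> i)) (at ?z)"
      by (rule has_derivative_transform_within_open[OF _ chart_nbhd[OF V]])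
         (auto simp: f_def cinv_cmap chart_at)
    from frechet_derivative_eq[OF this] show ?thesis by (simp add: dfun_def)
  qed
  note sum = D_sum[OF V, where X = "\<lambda>i q. f i q *\<^sub>R ext A p i q" and I = Basis and v = u, OF fE finite_Basis]
  have "D Y p u = D (\<lambda>q. \<Sum>i\<in>Basis. f i q *\<^sub>R ext A p i q) p u"
  proof -
    have "Y q = (\<Sum>i\<in>Basis. f i q *\<^sub>R ext A p i q)" if "q \<in> ?V" for q
      using that linear_eq_sum_Basis[OF linear_ext, of q p "field_rep A ?c Y (cmap ?c q)"]
      by (simp add: ext_field_rep f_def)
    then show ?thesis using D_cong[OF V(1) YV conjunct1[OF sum] V(2)] by simp
  qed
  also have "\<dots> = (\<Sum>i\<in>Basis. D (\<lambda>q. f i q *\<^sub>R ext A p i q) p u)" using sum by simp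
  also have "\<dots> = (\<Sum>i\<in>Basis. (?Y' u \<bullet> i) *\<^sub>R i + (Y p \<bullet> i) *\<^sub>R christoffel A D p u i)"
  proof (rule sum.cong[OF refl])
    fix i :: 'e
    have "D (\<lambda>q. f i q *\<^sub>R ext A p i q) p u = dfun A (f i) p u *\<^sub>R ext A p i p + f i p *\<^sub>R D (ext A p i) p u"
      by (intro D_scaleR[OF V(1) _ f V(2)] smooth_field_ext) auto
    then show "D (\<lambda>q. f i q *\<^sub>R ext A p i q) p u = (?Y' u \<bullet> i) *\<^sub>R i + (Y p \<bullet> i) *\<^sub>R christoffel A D p u i"
      by (simp add: df ext_same christoffel_def f_def field_rep_chart_at)
  qed
  also have "\<dots> = ?Y' u + christoffel A D p u (Y p)"
  proof -
    have "linear (christoffel A D p u)" using bilinear_christoffel by (simp add: bilinear_def)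
    then show ?thesis
      by (simp add: sum.distrib euclidean_representation linear_eq_sum_Basis[of _ "Y p", symmetric])
  qed
  finally show ?thesis .
qed

lemma torsion_eq:
  assumes "open U" "p \<in> U" "smooth_field A U X" "smooth_field A U Y"
  shows "torsion A D X Y p = christoffel A D p (X p) (Y p) - christoffel A D p (Y p) (X p)"
  using assms by (simp add: torsion_def lie_bracket_def Let_def D_coordinates)

lemma cov_End_eq:
  assumes "smooth_End A U J" "open U" "p \<in> U"
  shows "cov_End A D J p u v = dEnd A J p u v + christoffel A D p u (J p v) - J p (christoffel A D p u v)"
proof -
  have "smooth_field A (U \<inter> cdom (chart_at A p)) (\<lambda>q. J q (ext A p v q))"
    using assms chart_at(1)[of p] by (auto simp: smooth_End_def ext_def)
  from D_coordinates[OF _ _ this] assms chart_at_open chart_at(2) show ?thesis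
    by (simp add: cov_End_def dEnd_def christoffel_def ext_same open_Int)
qed

lemma cov_form_eq:
  "cov_form A D \<omega> p u v w = dform A \<omega> p u v w - \<omega> p (christoffel A D p u v) w - \<omega> p v (christoffel A D p u w)"
  by (simp add: cov_form_def dform_def christoffel_def)

end

section \<open>The adapted connection\<close>

text \<open>A non-degenerate form represents every linear functional; this is what makes the
  description in \<open>adapted_diff\<close> meaningful.\<close>

lemma nondegenerate_representation:
  fixes b :: "'e::euclidean_space \<Rightarrow> 'e \<Rightarrow> real"
  assumes b: "bilinear b" and nd: "\<And>u. (\<And>v. b u v = 0) \<Longrightarrow> u = 0" and f: "linear f"
  shows "\<exists>!a. \<forall>w. b a w = f w"
proof -
  \<comment> \<open>The functional \<open>b a\<close>, turned into a vector by the Euclidean inner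
    product. So \<open>T\<close> is an endomorphism of a finite-dimensional space, and injectivity
    gives surjectivity.\<close>
  define T where "T a = (\<Sum>i\<in>Basis. b a i *\<^sub>R i)" for a
  have Ti: "T a \<bullet> i = b a i" if "i \<in> Basis" for a i
    using that by (simp add: T_def inner_sum_left inner_Basis if_distrib sum.delta cong: if_cong)
  have lin: "linear T"
    unfolding T_def
    by (rule linearI) (simp_all add: bilinear_ladd[OF b] bilinear_lmul[OF b] scaleR_left_distrib
        sum.distrib scaleR_sum_right)
  have bw: "b a w = (\<Sum>i\<in>Basis. (w \<bullet> i) * b a i)" for a w
    using linear_eq_sum_Basis[of "b a" w] b by (simp add: bilinear_def)
  have fw: "f w = (\<Sum>i\<in>Basis. (w \<bullet> i) * f i)" for w
    using linear_eq_sum_Basis[OF f, of w] by simp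
  have "inj T"
    unfolding linear_injective_0[OF lin]
  proof (intro allI impI)
    fix a assume "T a = 0"
    then have "b a i = 0" if "i \<in> Basis" for i using Ti[OF that, of a] by simp
    then have "b a w = 0" for w unfolding bw[of a w] by simp
    then show "a = 0" by (rule nd)
  qed
  then have "surj T" by (rule linear_inj_imp_surj[OF lin])
  then obtain a where a: "T a = (\<Sum>i\<in>Basis. f i *\<^sub>R i)" by (metis surjD)
  have bi: "b a i = f i" if "i \<in> Basis" for i
    using Ti[OF that, of a] that unfolding a
    by (simp add: inner_sum_left inner_Basis if_distrib sum.delta cong: if_cong)
  have "b a w = f w" for w
    by (subst bw, subst fw, rule sum.cong) (simp_all add: bi)
  then have ex: "\<forall>w. b a w = f w" by blast
  show ?thesis
  proof (rule ex1I[of _ a])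
    fix a' assume "\<forall>w. b a' w = f w"
    then have "b (a' - a) w = 0" for w using ex by (simp add: bilinear_lsub[OF b])
    then have "a' - a = 0" by (rule nd)
    then show "a' = a" by simp
  qed (rule ex)
qed

lemma ext_deriv_eq:
  "ext_deriv A \<omega> p u v w = dform A \<omega> p u v w + dform A \<omega> p v w u + dform A \<omega> p w u v"
  by (simp add: ext_deriv_def dform_def)

locale connection_and_form = manifold_connection A D
  for A :: "('m::topological_space, 'e::euclidean_space) atlas" and D +
  fixes \<omega> :: "'m \<Rightarrow> 'e \<Rightarrow> 'e \<Rightarrow> real"
  assumes \<omega>: "two_form A \<omega>" and nondeg: "nondegenerate \<omega>"
begin

lemma bilinear_form: "bilinear (\<omega> p)"
  using \<omega> by (simp add: two_form_def)

lemma form_skew: "\<omega> p u v = - \<omega> p v u"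
  using \<omega> unfolding two_form_def by blast

lemmas form_simps = bilinear_ladd[OF bilinear_form] bilinear_radd[OF bilinear_form]
  bilinear_lsub[OF bilinear_form] bilinear_rsub[OF bilinear_form]
  bilinear_lmul[OF bilinear_form] bilinear_rmul[OF bilinear_form]
  bilinear_lneg[OF bilinear_form] bilinear_rneg[OF bilinear_form]

lemmas christoffel_simps = bilinear_ladd[OF bilinear_christoffel] bilinear_radd[OF bilinear_christoffel]
  bilinear_lmul[OF bilinear_christoffel] bilinear_rmul[OF bilinear_christoffel]
  bilinear_lneg[OF bilinear_christoffel] bilinear_rneg[OF bilinear_christoffel]

lemma form_eqI: "(\<And>w. \<omega> p a w = \<omega> p b w) \<Longrightarrow> a = b"
proof -
  assume "\<And>w. \<omega> p a w = \<omega> p b w"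
  then have "\<forall>w. \<omega> p (a - b) w = 0" by (simp add: form_simps)
  then have "a - b = 0" using nondeg unfolding nondegenerate_def by blast
  then show ?thesis by simp
qed

abbreviation B :: "'m \<Rightarrow> 'e \<Rightarrow> 'e \<Rightarrow> 'e" where "B \<equiv> adapted_diff A \<omega> D"

lemma linear_cov_form: "linear (\<lambda>w. cov_form A D \<omega> p u v w)"
  unfolding cov_form_eq
  by (rule linearI) (simp_all add: form_simps christoffel_simps linear_add[OF dform_linear2(2)[OF \<omega>]]
      linear_cmul[OF dform_linear2(2)[OF \<omega>]] algebra_simps)

lemma form_adapted_diff: "\<omega> p (B p u v) w = 1/2 * cov_form A D \<omega> p u v w"
proof -
  have "\<exists>!a. \<forall>w. \<omega> p a w = 1/2 * cov_form A D \<omega> p u v w"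
  proof (rule nondegenerate_representation[OF bilinear_form])
    show "linear (\<lambda>w. 1/2 * cov_form A D \<omega> p u v w)"
      using linear_compose_scale_right[OF linear_cov_form[of p u v], of "1/2"] by simp
  qed (use nondeg in \<open>auto simp: nondegenerate_def\<close>)
  from theI'[OF this] show ?thesis unfolding adapted_diff_def by blast
qed

text \<open>As \<open>B\<close> is defined by a description, its algebra is reached through its
  pairing with \<omega>, which separates vectors by \<open>form_eqI\<close>.\<close>

lemma bilinear_adapted_diff: "bilinear (B p)"
  unfolding bilinear_def
proof (intro conjI allI linearI)
  note lin = form_simps christoffel_simps form_adapted_diff cov_form_eq
    linear_add[OF dform_linear2(1)[OF \<omega>]] linear_cmul[OF dform_linear2(1)[OF \<omega>]]
    linear_add[OF linear_dform1[OF \<omega>]] linear_cmul[OF linear_dform1[OF \<omega>]]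
  fix u v w :: 'e and r :: real
  show "B p u (v + w) = B p u v + B p u w" by (rule form_eqI[of p]) (simp add: lin algebra_simps)
  show "B p u (r *\<^sub>R v) = r *\<^sub>R B p u v" by (rule form_eqI[of p]) (simp add: lin algebra_simps)
  show "B p (v + w) u = B p v u + B p w u" by (rule form_eqI[of p]) (simp add: lin algebra_simps)
  show "B p (r *\<^sub>R v) u = r *\<^sub>R B p v u" by (rule form_eqI[of p]) (simp add: lin algebra_simps)
qed

text \<open>This says that the adapted connection, with coefficients \<open>christoffel\<close> plus
  \<open>B\<close>, preserves \<omega>. The covariant derivative of \<omega> is skew in its last two
  arguments, so \<open>B\<close> acting in either slot contributes one half of it; this is the
  origin of the factor \<open>1/2\<close>.\<close>

lemma dform_adapted:
  "dform A \<omega> p u v w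
    = \<omega> p (christoffel A D p u v + B p u v) w - \<omega> p (christoffel A D p u w + B p u w) v"
  using form_adapted_diff[of p u v w] form_adapted_diff[of p u w v] dform_skew[OF \<omega>, of p u v w]
    form_skew[of p v "christoffel A D p u w"] form_skew[of p w "christoffel A D p u v"]
  by (simp add: cov_form_eq form_simps)

lemma torsion_adapted_connection:
  "torsion A (adapted_connection A \<omega> D) X Y p = torsion A D X Y p + B p (X p) (Y p) - B p (Y p) (X p)"
  by (simp add: torsion_def adapted_connection_def)

lemma cov_End_adapted_connection:
  "cov_End A (adapted_connection A \<omega> D) J p u v
    = cov_End A D J p u v + B p u (J p v) - J p (B p u v)" if "linear (J p)"
  by (simp add: cov_End_def adapted_connection_def ext_same linear_add[OF that])

lemma torsion_ext:
  "torsion A D (ext A p u) (ext A p v) p = christoffel A D p u v - christoffel A D p v u"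
  by (simp add: torsion_eq[OF chart_at_open chart_at(2)] smooth_field_ext ext_same)

lemma torsion_free_christoffel:
  assumes "torsion_free A D"
  shows "christoffel A D p u v = christoffel A D p v u"
proof -
  have "torsion A D (ext A p u) (ext A p v) p = 0"
    using assms chart_at_open[of p] chart_at(2)[of p] smooth_field_ext[of "cdom (chart_at A p)" p]
    unfolding torsion_free_def by blast
  then show ?thesis by (simp add: torsion_ext)
qed

lemma qsH_torsion_free_symmetric:
  assumes "qsH_torsion_free A \<omega> D"
  shows "christoffel A D p u v + B p u v = christoffel A D p v u + B p v u"
proof -
  have "torsion A (adapted_connection A \<omega> D) (ext A p u) (ext A p v) p = 0"
    using assms chart_at_open[of p] chart_at(2)[of p] smooth_field_ext[of "cdom (chart_at A p)" p]
    unfolding qsH_torsion_free_def torsion_free_def by blast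
  then show ?thesis by (simp add: torsion_adapted_connection torsion_ext ext_same algebra_simps)
qed

text \<open>The coefficients of the adapted connection preserve \<omega> and are now symmetric, so
  in the cyclic sum the six terms of \<open>dform_adapted\<close> cancel in pairs.\<close>

lemma qsH_torsion_free_closed:
  assumes "qsH_torsion_free A \<omega> D"
  shows "closed_form A \<omega>"
  unfolding closed_form_def ext_deriv_eq
proof (intro allI)
  fix p u v w
  show "dform A \<omega> p u v w + dform A \<omega> p v w u + dform A \<omega> p w u v = 0"
    using qsH_torsion_free_symmetric[OF assms, of p u v] qsH_torsion_free_symmetric[OF assms, of p v w]
      qsH_torsion_free_symmetric[OF assms, of p w u]
    by (simp add: dform_adapted)
qed

end

section \<open>Quaternionic structures\<close>

text \<open>The frame is indexed by the numerals 1, 2, 3, so \<open>J 1\<close> must keep this form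
  instead of becoming \<open>J (Suc 0)\<close>.\<close>

declare One_nat_def [simp del]

locale admissible_at =
  fixes A :: "('m::topological_space, 'e::euclidean_space) atlas"
    and Q :: "'m \<Rightarrow> ('e \<Rightarrow> 'e) set" and U :: "'m set" and J :: "nat \<Rightarrow> 'm \<Rightarrow> 'e \<Rightarrow> 'e" and p :: 'm
  assumes admissible: "admissible_basis A Q U J" and p: "p \<in> U"
begin

lemma open_U: "open U"
  using admissible by (simp add: admissible_basis_def)

lemma smooth_J: "smooth_End A U (J 1)" "smooth_End A U (J 2)" "smooth_End A U (J 3)"
  using admissible by (auto simp: admissible_basis_def)

lemma linear_J: "linear (J 1 p)" "linear (J 2 p)" "linear (J 3 p)"
  using smooth_J p by (auto simp: smooth_End_def)

lemmas J_linear_simps =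
  linear_J[THEN linear_add] linear_J[THEN linear_diff] linear_J[THEN linear_neg] linear_J[THEN linear_cmul]

lemma J_sq: "J 1 p (J 1 p v) = - v" "J 2 p (J 2 p v) = - v" "J 3 p (J 3 p v) = - v"
  using admissible p by (auto simp: admissible_basis_def)

lemma J12: "J 1 p (J 2 p v) = J 3 p v" and J21: "J 2 p (J 1 p v) = - J 3 p v"
  using admissible p by (auto simp: admissible_basis_def)

lemma J13: "J 1 p (J 3 p v) = - J 2 p v"
  using J_sq(1)[of "J 2 p v"] by (simp add: J12)

lemma J31: "J 3 p (J 1 p v) = J 2 p v"
  using J12[of "J 1 p v"] by (simp add: J21 J_linear_simps J13)

lemma J23: "J 2 p (J 3 p v) = J 1 p v"
proof -
  have "J 2 p (J 3 p v) = - J 2 p (J 2 p (J 1 p v))" by (simp add: J21 J_linear_simps)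
  then show ?thesis by (simp add: J_sq)
qed

lemmas J_simps = J_linear_simps J_sq J12 J21 J13 J31 J23

text \<open>With \<open>J 1\<close> as imaginary unit, applying \<open>J 2\<close> turns the
  relation into (a + b i) v = 0; multiplying by the conjugate gives (a^2 + b^2) v = 0.\<close>

lemma J2_J3_independent:
  assumes "a *\<^sub>R J 2 p v = b *\<^sub>R J 3 p v" and "v \<noteq> 0"
  shows "a = 0 \<and> b = 0"
proof -
  have 1: "- (a *\<^sub>R v) = b *\<^sub>R J 1 p v"
    using arg_cong[OF assms(1), of "J 2 p"] by (simp add: J_simps)
  have 2: "a *\<^sub>R J 1 p v = b *\<^sub>R v"
    using arg_cong[OF 1, of "J 1 p"] by (simp add: J_simps)
  have "(a * a + b * b) *\<^sub>R v = - (a *\<^sub>R - (a *\<^sub>R v)) + b *\<^sub>R (b *\<^sub>R v)"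
    by (simp add: scaleR_left_distrib)
  also have "\<dots> = 0" unfolding 1 2[symmetric] by (simp add: mult.commute)
  finally have "a * a + b * b = 0" using assms(2) by simp
  then show ?thesis by (simp add: sum_squares_eq_zero_iff)
qed

text \<open>\<open>G\<close> stands for the coefficients of a torsion-free connection, whose terms
  cancel by symmetry. What remains of the derivative of \<open>J 1\<close> along
  \<open>J 1 p u\<close>, minus \<open>J 1\<close> times its derivative along \<open>u\<close>, has
  \<open>J 2\<close> coefficient psi(u) and \<open>J 3\<close> coefficient psi(J1 u); this is where
  the combination \<open>psi\<close> comes from.\<close>

lemma nijenhuis_at_psi:
  assumes G: "bilinear G" and sym: "\<And>u v. G u v = G v u"
    and cov: "\<And>u v. dEnd A (J 1) p u v + G u (J 1 p v) - J 1 p (G u v)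
      = \<gamma> 3 p u *\<^sub>R J 2 p v - \<gamma> 2 p u *\<^sub>R J 3 p v"
    and lin: "\<And>v. linear (\<lambda>u. dEnd A (J 1) p u v)"
  shows "nijenhuis_at A (J 1) p u v = psi J \<gamma> p u *\<^sub>R J 2 p v - psi J \<gamma> p v *\<^sub>R J 2 p u
    + psi J \<gamma> p (J 1 p u) *\<^sub>R J 3 p v - psi J \<gamma> p (J 1 p v) *\<^sub>R J 3 p u"
proof -
  obtain b :: 'e where b: "b \<in> Basis" using nonempty_Basis by blast
  \<comment> \<open>\<open>connection_forms\<close> does not state linearity of
    \<open>\<gamma>\<close>, but psi(J1 u) contains \<open>\<gamma> 3\<close> at \<open>- u\<close>.
    Oddness is read off from \<open>cov\<close> at a nonzero vector, by independence of
    \<open>J 2\<close> and \<open>J 3\<close>.\<close>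
  have neg: "\<gamma> 3 p (- u) = - \<gamma> 3 p u" for u
  proof -
    have "\<gamma> 3 p (- u) *\<^sub>R J 2 p b - \<gamma> 2 p (- u) *\<^sub>R J 3 p b = - (\<gamma> 3 p u *\<^sub>R J 2 p b - \<gamma> 2 p u *\<^sub>R J 3 p b)"
      unfolding cov[symmetric] by (simp add: bilinear_lneg[OF G] linear_neg[OF lin] J_simps)
    then have "(\<gamma> 3 p (- u) + \<gamma> 3 p u) *\<^sub>R J 2 p b = (\<gamma> 2 p (- u) + \<gamma> 2 p u) *\<^sub>R J 3 p b"
      by (simp add: scaleR_left_distrib algebra_simps)
    from J2_J3_independent[OF this nonzero_Basis[OF b]] show ?thesis
      by (simp add: eq_neg_iff_add_eq_0)
  qed
  have dE: "dEnd A (J 1) p u v = \<gamma> 3 p u *\<^sub>R J 2 p v - \<gamma> 2 p u *\<^sub>R J 3 p v - G u (J 1 p v) + J 1 p (G u v)" for u v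
    using cov[of u v] by (simp add: algebra_simps)
  show ?thesis
    unfolding nijenhuis_at_def dE
    using sym[of "J 1 p u" v] sym[of "J 1 p v" u] sym[of u v] sym[of "J 1 p u" "J 1 p v"]
    by (simp add: J_simps psi_def neg scaleR_left_diff_distrib algebra_simps)
qed

end

section \<open>The Nijenhuis tensor under the two torsion conditions\<close>

context connection_and_form
begin

text \<open>
  As \<open>D J\<^sub>1\<close> lies in the span of \<open>J\<^sub>2\<close> and \<open>J\<^sub>3\<close>, the form \<open>D\<^sub>u\<omega>\<close> is again Hermitian with
  respect to \<open>J\<^sub>1\<close>.
\<close>

lemma adapted_diff_commutes:
  assumes adm: "admissible_basis A Q U J" and p: "p \<in> U" and Q: "preserves_Q A Q D"
    and herm: "\<And>a q v w. a \<in> {1,2,3} \<Longrightarrow> q \<in> U \<Longrightarrow> \<omega> q (J a q v) (J a q w) = \<omega> q v w"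
  shows "B p u (J 1 p v) = J 1 p (B p u v)"
proof -
  interpret admissible_at A Q U J p using adm p by unfold_locales
  have "J 1 q \<in> Q q" if "q \<in> U" for q
  proof -
    have "Q q = {(\<lambda>v. r *\<^sub>R J 1 q v + s *\<^sub>R J 2 q v + t *\<^sub>R J 3 q v) | r s t. True}"
      using adm that by (simp add: admissible_basis_def)
    \<comment> \<open>\<open>J 1\<close> is the section of \<open>Q\<close> with coefficients 1, 0,
      0, so \<open>preserves_Q\<close> applies to it.\<close>
    moreover have "J 1 q = (\<lambda>v. 1 *\<^sub>R J 1 q v + 0 *\<^sub>R J 2 q v + 0 *\<^sub>R J 3 q v)" by simp
    ultimately show ?thesis by blast
  qed
  then have "cov_End A D (J 1) p u \<in> Q p"
    using Q open_U smooth_J(1) p unfolding preserves_Q_def by blast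
  moreover have "Q p = {(\<lambda>v. r *\<^sub>R J 1 p v + s *\<^sub>R J 2 p v + t *\<^sub>R J 3 p v) | r s t. True}"
    using adm p by (simp add: admissible_basis_def)
  ultimately obtain r s t where
    "cov_End A D (J 1) p u = (\<lambda>v. r *\<^sub>R J 1 p v + s *\<^sub>R J 2 p v + t *\<^sub>R J 3 p v)" by blast
  then have S: "dEnd A (J 1) p u v + christoffel A D p u (J 1 p v) - J 1 p (christoffel A D p u v)
      = r *\<^sub>R J 1 p v + s *\<^sub>R J 2 p v + t *\<^sub>R J 3 p v" for v
    unfolding cov_End_eq[OF smooth_J(1) open_U p, symmetric] by simp
  have dE: "dEnd A (J 1) p u v = r *\<^sub>R J 1 p v + s *\<^sub>R J 2 p v + t *\<^sub>R J 3 p v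
      - christoffel A D p u (J 1 p v) + J 1 p (christoffel A D p u v)" for v
    using S[of v] by (simp add: algebra_simps)
  obtain b :: 'e where b: "b \<in> Basis" using nonempty_Basis by blast
  \<comment> \<open>The covariant derivative of \<open>J 1\<close> must anticommute with
    \<open>J 1\<close>. The \<open>J 2\<close> and \<open>J 3\<close> components do so, while the
    \<open>J 1\<close> component leaves -2 r b, whence r = 0.\<close>
  have "dEnd A (J 1) p u (J 1 p b) + J 1 p (dEnd A (J 1) p u b) = 0"
    by (rule dEnd_involution[OF smooth_J(1) open_U p]) (use adm in \<open>auto simp: admissible_basis_def\<close>)
  then have "(2 * r) *\<^sub>R b = 0"
    unfolding dE by (simp add: J_simps christoffel_simps algebra_simps flip: scaleR_2)
  then have r: "r = 0" using b by auto
  have h: "\<omega> p (J 1 p x) (J 1 p y) = \<omega> p x y" "\<omega> p (J 2 p x) (J 2 p y) = \<omega> p x y"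
    "\<omega> p (J 3 p x) (J 3 p y) = \<omega> p x y" for x y
    using herm p by auto
  \<comment> \<open>These identities make the \<open>s\<close> and \<open>t\<close> terms cancel in
    \<open>C\<close> below; an \<open>r\<close> term would instead survive as a multiple of
    \<omega>.\<close>
  have cross: "\<omega> p (J 2 p x) (J 1 p y) = - \<omega> p (J 3 p x) y" "\<omega> p (J 1 p x) (J 2 p y) = \<omega> p (J 3 p x) y"
    "\<omega> p (J 3 p x) (J 1 p y) = \<omega> p (J 2 p x) y" "\<omega> p (J 1 p x) (J 3 p y) = - \<omega> p (J 2 p x) y" for x y
    using h(1)[of "J 2 p x" "J 1 p y"] h(2)[of "J 1 p x" "J 2 p y"]
      h(1)[of "J 3 p x" "J 1 p y"] h(3)[of "J 1 p x" "J 3 p y"]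
    by (simp_all add: J_simps form_simps)
  have C: "cov_form A D \<omega> p u (J 1 p v) (J 1 p w) = cov_form A D \<omega> p u v w" for v w
  proof -
    have "dform A \<omega> p u (J 1 p v) (J 1 p w) + \<omega> p (dEnd A (J 1) p u v) (J 1 p w)
        + \<omega> p (J 1 p v) (dEnd A (J 1) p u w) = dform A \<omega> p u v w"
      by (rule dform_hermitian[OF \<omega> smooth_J(1) open_U p]) (use herm in auto)
    then show ?thesis
      unfolding cov_form_eq dE by (simp add: r form_simps h cross algebra_simps)
  qed
  show ?thesis
  proof (rule form_eqI[of p])
    fix w
    \<comment> \<open>The test vector \<open>w\<close> is written as
      \<open>J 1 p (- J 1 p w)\<close>, so that \<open>J 1\<close> stands in both slots and can be
      removed by \<open>C\<close> on the left and by \<open>h(1)\<close> on the right.\<close>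
    have "\<omega> p (B p u (J 1 p v)) (J 1 p (- J 1 p w)) = \<omega> p (J 1 p (B p u v)) (J 1 p (- J 1 p w))"
      unfolding form_adapted_diff C h(1) ..
    then show "\<omega> p (B p u (J 1 p v)) w = \<omega> p (J 1 p (B p u v)) w" by (simp add: J_simps)
  qed
qed

lemma nijenhuis_at_admissible:
  assumes adm: "admissible_basis A Q U J" and p: "p \<in> U" and Q: "preserves_Q A Q D"
    and herm: "\<And>a q v w. a \<in> {1,2,3} \<Longrightarrow> q \<in> U \<Longrightarrow> \<omega> q (J a q v) (J a q w) = \<omega> q v w"
    and forms: "connection_forms A (adapted_connection A \<omega> D) U J \<gamma>"
    and tf: "qsH_torsion_free A \<omega> D \<or> torsion_free A D"
  shows "nijenhuis_at A (J 1) p u v = psi J \<gamma> p u *\<^sub>R J 2 p v - psi J \<gamma> p v *\<^sub>R J 2 p u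
    + psi J \<gamma> p (J 1 p u) *\<^sub>R J 3 p v - psi J \<gamma> p (J 1 p v) *\<^sub>R J 3 p u"
proof -
  interpret admissible_at A Q U J p using adm p by unfold_locales
  have "cov_End A (adapted_connection A \<omega> D) (J 1) p u v = \<gamma> 3 p u *\<^sub>R J 2 p v - \<gamma> 2 p u *\<^sub>R J 3 p v" for u v
    using forms p unfolding connection_forms_def by auto
  then have cov: "dEnd A (J 1) p u v + christoffel A D p u (J 1 p v) - J 1 p (christoffel A D p u v)
      + B p u (J 1 p v) - J 1 p (B p u v) = \<gamma> 3 p u *\<^sub>R J 2 p v - \<gamma> 2 p u *\<^sub>R J 3 p v" for u v
    by (simp add: cov_End_adapted_connection linear_J cov_End_eq[OF smooth_J(1) open_U p])
  have lin: "linear (\<lambda>u. dEnd A (J 1) p u v)" for v by (rule linear_dEnd1[OF smooth_J(1) p])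
  show ?thesis
    using tf
  proof
    assume tf: "qsH_torsion_free A \<omega> D"
    show ?thesis
    proof (rule nijenhuis_at_psi[where G = "\<lambda>u v. christoffel A D p u v + B p u v"])
      show "bilinear (\<lambda>u v. christoffel A D p u v + B p u v)"
        using bilinear_christoffel[of p] bilinear_adapted_diff[of p]
        by (auto simp: bilinear_def intro: linear_compose_add)
      show "dEnd A (J 1) p u v + (christoffel A D p u (J 1 p v) + B p u (J 1 p v))
          - J 1 p (christoffel A D p u v + B p u v) = \<gamma> 3 p u *\<^sub>R J 2 p v - \<gamma> 2 p u *\<^sub>R J 3 p v" for u v
        using cov[of u v] by (simp add: J_simps algebra_simps)
    qed (rule qsH_torsion_free_symmetric[OF tf], rule lin)
  next
    assume tf: "torsion_free A D"
    show ?thesis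
    proof (rule nijenhuis_at_psi[where G = "christoffel A D p", OF bilinear_christoffel
          torsion_free_christoffel[OF tf] _ lin])
      show "dEnd A (J 1) p u v + christoffel A D p u (J 1 p v) - J 1 p (christoffel A D p u v)
          = \<gamma> 3 p u *\<^sub>R J 2 p v - \<gamma> 2 p u *\<^sub>R J 3 p v" for u v
        \<comment> \<open>The forms \<open>\<gamma>\<close> belong to the adapted connection; the
          two \<open>B\<close> terms in \<open>cov\<close> cancel, so the same forms describe the
          derivative of \<open>J 1\<close> under \<open>D\<close>.\<close>
        using cov[of u v] adapted_diff_commutes[OF adm p Q herm, of u v] by simp
    qed
  qed
qed

end

section \<open>Submanifolds\<close>

locale smooth_mapping =
  M: smooth_manifold A + N: smooth_manifold B
  for A :: "('m::topological_space, 'e::euclidean_space) atlas"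
    and B :: "('n::topological_space, 'f::euclidean_space) atlas" +
  fixes \<iota> :: "'n \<Rightarrow> 'm"
  assumes smooth: "smooth_map A B \<iota>"
begin

lemma open_vimage: "open U \<Longrightarrow> open (\<iota> -` U)"
  using smooth by (simp add: smooth_map_def open_vimage)

lemma map_rep_smooth:
  "c \<in> A \<Longrightarrow> b \<in> B \<Longrightarrow> smooth_on (cmap b ` (\<iota> -` cdom c \<inter> cdom b)) (cmap c \<circ> \<iota> \<circ> cinv b)"
  using smooth by (simp add: smooth_map_def Int_commute)

text \<open>\<open>tmap\<close> at nearby points switches charts; this is its version in a fixed
  pair of charts, the one that can be differentiated.\<close>

definition tmap_rep :: "('m, 'e) chart \<Rightarrow> ('n, 'f) chart \<Rightarrow> 'n \<Rightarrow> 'f \<Rightarrow> 'e" where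
  "tmap_rep c b q = frechet_derivative (cmap c \<circ> \<iota> \<circ> cinv b) (at (cmap b q))"

lemma tmap_rep_has_derivative:
  assumes "c \<in> A" "b \<in> B" "q \<in> cdom b" "\<iota> q \<in> cdom c"
  shows "(cmap c \<circ> \<iota> \<circ> cinv b has_derivative tmap_rep c b q) (at (cmap b q))"
  unfolding tmap_rep_def
  by (rule smooth_on_has_derivative[OF map_rep_smooth[OF assms(1,2)]]) (use assms in auto)

lemma tmap_rep_transition:
  assumes "c \<in> A" "b \<in> B" "b' \<in> B" "q \<in> cdom b" "q \<in> cdom b'" "\<iota> q \<in> cdom c"
  shows "tmap_rep c b' q (transition b b' q v) = tmap_rep c b q v"
proof -
  have "(cmap c \<circ> \<iota> \<circ> cinv b' has_derivative tmap_rep c b' q) (at ((cmap b' \<circ> cinv b) (cmap b q)))"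
    using assms tmap_rep_has_derivative by (simp add: N.cinv_cmap)
  from diff_chain_at[OF N.transition_has_derivative[of b b' q] this]
  have "((cmap c \<circ> \<iota> \<circ> cinv b') \<circ> (cmap b' \<circ> cinv b) has_derivative
      tmap_rep c b' q \<circ> transition b b' q) (at (cmap b q))"
    using assms by blast
  then have "(cmap c \<circ> \<iota> \<circ> cinv b has_derivative tmap_rep c b' q \<circ> transition b b' q) (at (cmap b q))"
    by (rule has_derivative_transform_within_open[OF _ N.open_chart_image[of b "cdom b'"]])
       (use assms in \<open>auto simp: N.open_cdom N.cinv_cmap\<close>)
  from frechet_derivative_eq[OF this] show ?thesis by (simp add: tmap_rep_def)
qed

lemma transition_tmap_rep:
  assumes "c \<in> A" "c' \<in> A" "b \<in> B" "q \<in> cdom b" "\<iota> q \<in> cdom c" "\<iota> q \<in> cdom c'"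
  shows "transition c c' (\<iota> q) (tmap_rep c b q v) = tmap_rep c' b q v"
proof -
  have "(cmap c' \<circ> cinv c has_derivative transition c c' (\<iota> q)) (at ((cmap c \<circ> \<iota> \<circ> cinv b) (cmap b q)))"
    using assms M.transition_has_derivative by (simp add: N.cinv_cmap)
  from diff_chain_at[OF tmap_rep_has_derivative[of c b q] this]
  have "((cmap c' \<circ> cinv c) \<circ> (cmap c \<circ> \<iota> \<circ> cinv b) has_derivative
      transition c c' (\<iota> q) \<circ> tmap_rep c b q) (at (cmap b q))"
    using assms by blast
  then have "(cmap c' \<circ> \<iota> \<circ> cinv b has_derivative transition c c' (\<iota> q) \<circ> tmap_rep c b q) (at (cmap b q))"
    by (rule has_derivative_transform_within_open[OF _ N.open_chart_image[of b "\<iota> -` cdom c"]])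
       (use assms in \<open>auto simp: N.cinv_cmap M.cinv_cmap M.open_cdom open_vimage\<close>)
  from frechet_derivative_eq[OF this] show ?thesis by (simp add: tmap_rep_def)
qed

lemma tmap_eq: "tmap A B \<iota> q v = tmap_rep (chart_at A (\<iota> q)) (chart_at B q) q v"
  by (simp add: tmap_def tmap_rep_def)

lemma linear_tmap: "linear (tmap A B \<iota> q)"
  using has_derivative_linear[OF tmap_rep_has_derivative[OF M.chart_at(1) N.chart_at(1) N.chart_at(2) M.chart_at(2), of q]]
  by (simp add: tmap_eq[abs_def])

lemma tmap_coord_field:
  assumes "c \<in> A" "b \<in> B" "q \<in> cdom b" "\<iota> q \<in> cdom c"
  shows "tmap A B \<iota> q (coord_field B b v q) = coord_field A c (tmap_rep c b q v) (\<iota> q)"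
  using assms by (simp add: tmap_eq coord_field_transition tmap_rep_transition transition_tmap_rep
      M.chart_at N.chart_at)

lemma tcoord_tmap:
  assumes "c \<in> A" "b \<in> B" "q \<in> cdom b" "\<iota> q \<in> cdom c"
  shows "tcoord A c (\<iota> q) (tmap A B \<iota> q w) = tmap_rep c b q (tcoord B b q w)"
  using assms tmap_coord_field[OF assms, of "tcoord B b q w"]
  by (simp add: N.coord_field_tcoord M.tcoord_coord_field_self)

text \<open>The second partial derivatives of \<iota> in the charts at \<open>x\<close> and
  \<open>\<iota> x\<close>. They are the correction terms by which \<open>dEnd\<close> and
  \<open>dform\<close> fail to be compatible with the map.\<close>

definition d2map :: "'n \<Rightarrow> 'f \<Rightarrow> 'f \<Rightarrow> 'e" where
  "d2map x u v = frechet_derivative (\<lambda>y. frechet_derivative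
     (cmap (chart_at A (\<iota> x)) \<circ> \<iota> \<circ> cinv (chart_at B x)) (at y) v) (at (cmap (chart_at B x) x)) u"

lemma map_nbhd:
  assumes "open V" "x \<in> V"
  defines "W \<equiv> V \<inter> \<iota> -` cdom (chart_at A (\<iota> x))"
  shows "open (cmap (chart_at B x) ` (W \<inter> cdom (chart_at B x)))"
    and "cmap (chart_at B x) x \<in> cmap (chart_at B x) ` (W \<inter> cdom (chart_at B x))"
  using N.chart_nbhd[of W x] assms by (auto intro!: open_vimage M.chart_at_open M.chart_at)

lemma d2map_symmetric: "d2map x u v = d2map x v u"
  unfolding d2map_def
  by (rule second_derivative_symmetric[OF map_rep_smooth[OF M.chart_at(1) N.chart_at(1)]])
     (use map_nbhd[of UNIV x] in auto)

lemma d2map_has_derivative: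
  "((\<lambda>y. frechet_derivative (cmap (chart_at A (\<iota> x)) \<circ> \<iota> \<circ> cinv (chart_at B x)) (at y) v)
    has_derivative (\<lambda>u. d2map x u v)) (at (cmap (chart_at B x) x))"
  unfolding d2map_def
  by (rule smooth_on_has_derivative[OF smooth_on_frechet_derivative[OF
        map_rep_smooth[OF M.chart_at(1) N.chart_at(1)]]])
     (use map_nbhd[of UNIV x] in auto)

lemma map_rep_has_derivative:
  "(cmap (chart_at A (\<iota> x)) \<circ> \<iota> \<circ> cinv (chart_at B x) has_derivative tmap A B \<iota> x)
    (at (cmap (chart_at B x) x))"
  using tmap_rep_has_derivative[OF M.chart_at(1) N.chart_at(1) N.chart_at(2) M.chart_at(2), of x]
  by (simp add: tmap_eq[abs_def])

lemma map_rep_at: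
  "(cmap (chart_at A (\<iota> x)) \<circ> \<iota> \<circ> cinv (chart_at B x)) (cmap (chart_at B x) x) = cmap (chart_at A (\<iota> x)) (\<iota> x)"
  by (simp add: N.cinv_chart_at)

text \<open>Both sides of \<open>rel\<close>, read in the two fixed charts and applied to a field
  with constant components \<open>v\<close>, are families of linear maps at a moving vector.
  Equating their derivatives gives the claim; the \<open>d2map\<close> terms come from
  differentiating the Jacobian of \<iota>.\<close>

lemma dEnd_related:
  assumes J: "smooth_End A U J" and U: "open U" and Jh: "smooth_End B V Jh" and V: "open V" "x \<in> V"
    and VU: "\<iota> ` V \<subseteq> U"
    and rel: "\<And>q v. q \<in> V \<Longrightarrow> J (\<iota> q) (tmap A B \<iota> q v) = tmap A B \<iota> q (Jh q v)"
  shows "dEnd A J (\<iota> x) (tmap A B \<iota> x u) (tmap A B \<iota> x v) + J (\<iota> x) (d2map x u v)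
    = d2map x u (Jh x v) + tmap A B \<iota> x (dEnd B Jh x u v)"
proof -
  let ?c = "chart_at A (\<iota> x)" and ?b = "chart_at B x" and ?z = "cmap (chart_at B x) x"
  let ?\<phi> = "cmap ?c \<circ> \<iota> \<circ> cinv ?b"
  let ?W = "cmap ?b ` ((V \<inter> \<iota> -` cdom ?c) \<inter> cdom ?b)"
  let ?F = "\<lambda>y a. field_rep A ?c (\<lambda>q. J q (ext A (\<iota> x) a q)) y"
  let ?Fh = "\<lambda>y. field_rep B ?b (\<lambda>q. Jh q (ext B x v q)) y"
  note nb = map_nbhd[OF V]
  have px: "\<iota> x \<in> U" using V VU by auto
  have 1: "((\<lambda>y. ?F (?\<phi> y) (frechet_derivative ?\<phi> (at y) v)) has_derivative
     (\<lambda>u. dEnd A J (\<iota> x) (tmap A B \<iota> x u) (frechet_derivative ?\<phi> (at ?z) v) + ?F (?\<phi> ?z) (d2map x u v))) (at ?z)"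
  proof (rule has_derivative_linear_family[OF nb, where F = "\<lambda>y. ?F (?\<phi> y)"])
    show "linear (?F (?\<phi> y))" if y: "y \<in> ?W" for y
    proof -
      obtain q where q: "q \<in> V" "\<iota> q \<in> cdom ?c" "q \<in> cdom ?b" "y = cmap ?b q" using y by auto
      then have "linear (J (\<iota> q))" using J VU by (auto simp: smooth_End_def)
      from M.linear_End_rep[where J = J, OF q(2) this] q show ?thesis by (simp add: N.cinv_cmap N.chart_at)
    qed
    show "((\<lambda>y. ?F (?\<phi> y) a) has_derivative (\<lambda>u. dEnd A J (\<iota> x) (tmap A B \<iota> x u) a)) (at ?z)" for a
      using has_derivative_compose[OF map_rep_has_derivative, of "\<lambda>y. ?F y a" _ x]
        M.dEnd_has_derivative[OF J px, of a] by (simp add: map_rep_at del: o_apply)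
  qed (rule d2map_has_derivative)
  have 2: "((\<lambda>y. frechet_derivative ?\<phi> (at y) (?Fh y)) has_derivative
     (\<lambda>u. d2map x u (?Fh ?z) + frechet_derivative ?\<phi> (at ?z) (dEnd B Jh x u v))) (at ?z)"
  proof (rule has_derivative_linear_family[OF nb, where F = "\<lambda>y. frechet_derivative ?\<phi> (at y)"])
    show "linear (frechet_derivative ?\<phi> (at y))" if y: "y \<in> ?W" for y
    proof -
      obtain q where q: "\<iota> q \<in> cdom ?c" "q \<in> cdom ?b" "y = cmap ?b q" using y by auto
      from has_derivative_linear[OF tmap_rep_has_derivative[OF M.chart_at(1) N.chart_at(1) q(2,1)]]
      show ?thesis by (simp add: tmap_rep_def q)
    qed
  qed (rule d2map_has_derivative, rule N.dEnd_has_derivative[OF Jh V(2)])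
  have "?F (?\<phi> y) (frechet_derivative ?\<phi> (at y) v) = frechet_derivative ?\<phi> (at y) (?Fh y)"
    if y: "y \<in> ?W" for y
  proof -
    obtain q where q: "q \<in> V" "\<iota> q \<in> cdom ?c" "q \<in> cdom ?b" "y = cmap ?b q" using y by auto
    note cb = M.chart_at(1) N.chart_at(1) q(3,2)
    have "?F (?\<phi> y) (frechet_derivative ?\<phi> (at y) v)
        = tcoord A ?c (\<iota> q) (J (\<iota> q) (tmap A B \<iota> q (ext B x v q)))"
      using q by (simp add: field_rep_def N.cinv_cmap M.cinv_cmap N.chart_at M.chart_at ext_def
          tmap_coord_field[OF cb] tmap_rep_def)
    also have "\<dots> = tmap_rep ?c ?b q (tcoord B ?b q (Jh q (ext B x v q)))"
      by (simp add: rel[OF q(1)] tcoord_tmap[OF cb])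
    also have "\<dots> = frechet_derivative ?\<phi> (at y) (?Fh y)"
      using q by (simp add: tmap_rep_def field_rep_def N.cinv_cmap N.chart_at)
    finally show ?thesis .
  qed
  from has_derivative_unique[OF has_derivative_transform_within_open[OF 1 nb this] 2]
  show ?thesis
    by (simp add: fun_eq_iff map_rep_at N.cinv_chart_at M.field_rep_chart_at N.field_rep_chart_at
        M.ext_same N.ext_same tmap_def)
qed

text \<open>Each of the four terms of \<open>nijenhuis_at\<close> brings two corrections from
  \<open>dEnd_related\<close>; all eight cancel in pairs by \<open>d2map_symmetric\<close>.\<close>

lemma nijenhuis_at_related:
  assumes J: "smooth_End A U J" and U: "open U" and Jh: "smooth_End B V Jh" and V: "open V" "x \<in> V"
    and VU: "\<iota> ` V \<subseteq> U"
    and rel: "\<And>q v. q \<in> V \<Longrightarrow> J (\<iota> q) (tmap A B \<iota> q v) = tmap A B \<iota> q (Jh q v)"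
  shows "tmap A B \<iota> x (nijenhuis_at B Jh x u v)
    = nijenhuis_at A J (\<iota> x) (tmap A B \<iota> x u) (tmap A B \<iota> x v)"
proof -
  have linJ: "linear (J (\<iota> x))" using J V VU by (auto simp: smooth_End_def)
  note lin = linear_add[OF linear_tmap] linear_diff[OF linear_tmap] linear_add[OF linJ] linear_diff[OF linJ]
  have eq: "tmap A B \<iota> x (dEnd B Jh x u v) = dEnd A J (\<iota> x) (tmap A B \<iota> x u) (tmap A B \<iota> x v)
      + J (\<iota> x) (d2map x u v) - d2map x u (Jh x v)" for u v
    using dEnd_related[OF assms, of u v] by (simp add: algebra_simps)
  have eq': "tmap A B \<iota> x (Jh x (dEnd B Jh x u v)) = J (\<iota> x) (dEnd A J (\<iota> x) (tmap A B \<iota> x u) (tmap A B \<iota> x v)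
      + J (\<iota> x) (d2map x u v) - d2map x u (Jh x v))" for u v
    unfolding rel[OF V(2), symmetric] eq ..
  show ?thesis
    unfolding nijenhuis_at_def
    by (simp add: lin eq eq' rel[OF V(2)] d2map_symmetric[of x u "Jh x v"]
        d2map_symmetric[of x v "Jh x u"] d2map_symmetric[of x u v]
        d2map_symmetric[of x "Jh x u" "Jh x v"])
qed

lemma dform_pullback:
  assumes \<omega>: "two_form A \<omega>"
  shows "dform B (pullback_form A B \<iota> \<omega>) x u v w
    = dform A \<omega> (\<iota> x) (tmap A B \<iota> x u) (tmap A B \<iota> x v) (tmap A B \<iota> x w)
      + \<omega> (\<iota> x) (d2map x u v) (tmap A B \<iota> x w) + \<omega> (\<iota> x) (tmap A B \<iota> x v) (d2map x u w)"
proof -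
  let ?c = "chart_at A (\<iota> x)" and ?b = "chart_at B x" and ?z = "cmap (chart_at B x) x"
  let ?\<phi> = "cmap ?c \<circ> \<iota> \<circ> cinv ?b"
  let ?W = "cmap ?b ` ((UNIV \<inter> \<iota> -` cdom ?c) \<inter> cdom ?b)"
  let ?F = "\<lambda>y a b. \<omega> (cinv ?c y) (ext A (\<iota> x) a (cinv ?c y)) (ext A (\<iota> x) b (cinv ?c y))"
  note nb = map_nbhd[OF open_UNIV UNIV_I, of x]
  have 1: "((\<lambda>y. ?F (?\<phi> y) (frechet_derivative ?\<phi> (at y) v) (frechet_derivative ?\<phi> (at y) w)) has_derivative
     (\<lambda>u. dform A \<omega> (\<iota> x) (tmap A B \<iota> x u) (frechet_derivative ?\<phi> (at ?z) v) (frechet_derivative ?\<phi> (at ?z) w)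
       + ?F (?\<phi> ?z) (d2map x u v) (frechet_derivative ?\<phi> (at ?z) w)
       + ?F (?\<phi> ?z) (frechet_derivative ?\<phi> (at ?z) v) (d2map x u w))) (at ?z)"
  proof (rule has_derivative_bilinear_family[OF nb, where W = "\<lambda>y. ?F (?\<phi> y)"])
    show "bilinear (?F (?\<phi> y))" if y: "y \<in> ?W" for y
    proof -
      obtain q where q: "\<iota> q \<in> cdom ?c" "q \<in> cdom ?b" "y = cmap ?b q" using y by auto
      from M.bilinear_form_rep[OF \<omega> q(1)] show ?thesis
        using q by (simp add: N.cinv_cmap M.cinv_cmap N.chart_at M.chart_at)
    qed
    show "((\<lambda>y. ?F (?\<phi> y) a b) has_derivative (\<lambda>u. dform A \<omega> (\<iota> x) (tmap A B \<iota> x u) a b)) (at ?z)" for a b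
      using has_derivative_compose[OF map_rep_has_derivative, of "\<lambda>y. ?F y a b" _ x]
        M.dform_has_derivative[OF \<omega>, of "\<iota> x" a b] by (simp add: map_rep_at del: o_apply)
  qed (rule d2map_has_derivative)+
  have "?F (?\<phi> y) (frechet_derivative ?\<phi> (at y) v) (frechet_derivative ?\<phi> (at y) w)
      = ((\<lambda>q. pullback_form A B \<iota> \<omega> q (ext B x v q) (ext B x w q)) \<circ> cinv ?b) y"
    if y: "y \<in> ?W" for y
  proof -
    obtain q where q: "\<iota> q \<in> cdom ?c" "q \<in> cdom ?b" "y = cmap ?b q" using y by auto
    note cb = M.chart_at(1) N.chart_at(1) q(2,1)
    show ?thesis
      using q by (simp add: N.cinv_cmap M.cinv_cmap N.chart_at M.chart_at ext_def pullback_form_def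
          tmap_coord_field[OF cb] tmap_rep_def)
  qed
  from frechet_derivative_eq[OF has_derivative_transform_within_open[OF 1 nb this]]
  show ?thesis
    by (simp add: dform_def[of B] dfun_def map_rep_at N.cinv_chart_at M.cinv_chart_at M.ext_same
        tmap_def o_def)
qed

text \<open>In the cyclic sum each second derivative of \<iota> appears twice: symmetry of
  \<open>d2map\<close> makes the vectors equal and skewness of \<omega> makes the signs
  opposite.\<close>

lemma closed_pullback:
  assumes \<omega>: "two_form A \<omega>" and closed: "closed_form A \<omega>"
  shows "closed_form B (pullback_form A B \<iota> \<omega>)"
  unfolding closed_form_def ext_deriv_eq
proof (intro allI)
  fix x u v w
  let ?T = "tmap A B \<iota> x"
  have skew: "\<omega> (\<iota> x) (?T a) (d2map x b c) = - \<omega> (\<iota> x) (d2map x b c) (?T a)" for a b c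
    using \<omega> unfolding two_form_def by blast
  have "dform A \<omega> (\<iota> x) (?T u) (?T v) (?T w) + dform A \<omega> (\<iota> x) (?T v) (?T w) (?T u)
      + dform A \<omega> (\<iota> x) (?T w) (?T u) (?T v) = 0"
    using closed unfolding closed_form_def ext_deriv_eq by blast
  then show "dform B (pullback_form A B \<iota> \<omega>) x u v w + dform B (pullback_form A B \<iota> \<omega>) x v w u
      + dform B (pullback_form A B \<iota> \<omega>) x w u v = 0"
    using d2map_symmetric[of x u v] d2map_symmetric[of x u w] d2map_symmetric[of x v w]
    by (simp add: dform_pullback[OF \<omega>] skew)
qed

end

text \<open>The plane spanned by \<open>u\<close> and \<open>J u\<close> is invariant under
  \<open>J\<close>, and a - b J is invertible by its conjugate a + b J unless a = b = 0. So it can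
  send a vector outside the plane into it only by vanishing.\<close>

lemma complex_proportionality_vanishes:
  fixes J :: "'f::euclidean_space \<Rightarrow> 'f" and f :: "'f \<Rightarrow> real"
  assumes J: "linear J" "\<And>v. J (J v) = - v" and dim: "2 < DIM('f)"
    and eq: "\<And>u v. f u *\<^sub>R v - f (J u) *\<^sub>R J v = f v *\<^sub>R u - f (J v) *\<^sub>R J u"
  shows "f u = 0"
proof -
  have "dim (span {u, J u}) \<le> card {u, J u}" by (rule dim_le_card) auto
  also have "\<dots> \<le> 2" by (simp add: card_insert_if)
  finally have "span {u, J u} \<noteq> UNIV" using dim by (metis dim_UNIV not_le)
  then obtain v where v: "v \<notin> span {u, J u}" by auto
  have c: "c = 0" if "c *\<^sub>R v \<in> span {u, J u}" for c
    using span_scale[OF that, of "inverse c"] v by (cases "c = 0") auto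
  define a where "a = f u"
  define b where "b = f (J u)"
  have *: "a *\<^sub>R v - b *\<^sub>R J v = f v *\<^sub>R u - f (J v) *\<^sub>R J u" unfolding a_def b_def by (rule eq)
  \<comment> \<open>Multiplication of \<open>*\<close> by the conjugate a + b J.\<close>
  have "(a * a + b * b) *\<^sub>R v = a *\<^sub>R (a *\<^sub>R v - b *\<^sub>R J v) + b *\<^sub>R J (a *\<^sub>R v - b *\<^sub>R J v)"
    by (simp add: linear_diff[OF J(1)] linear_cmul[OF J(1)] J(2) algebra_simps)
  also have "\<dots> = a *\<^sub>R (f v *\<^sub>R u - f (J v) *\<^sub>R J u) + b *\<^sub>R (f v *\<^sub>R J u + f (J v) *\<^sub>R u)"
    unfolding * by (simp add: linear_diff[OF J(1)] linear_cmul[OF J(1)] J(2))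
  also have "\<dots> \<in> span {u, J u}"
    by (intro span_add span_diff span_scale span_base) auto
  finally have "a * a + b * b = 0" by (rule c)
  then show ?thesis by (simp add: a_def sum_squares_eq_zero_iff)
qed

text \<open>The bound \<open>1 < k\<close> belongs to the direction from pseudo-Kaehler to vanishing
  \<open>psi\<close>: on a surface every almost complex structure is integrable, so integrability
  says nothing about \<open>psi\<close>. Quantifying over every family \<open>F\<close> makes the
  criterion independent of the choice of adapted bases.\<close>

theorem corollary2p21:
  fixes A :: "('m::{t2_space,second_countable_topology}, 'e::euclidean_space) atlas"
    and Q :: "'m \<Rightarrow> ('e \<Rightarrow> 'e) set"
    and \<omega> :: "'m \<Rightarrow> 'e \<Rightarrow> 'e \<Rightarrow> real"
    and D :: "('m, 'e) conn"
    and B :: "('n::{t2_space,second_countable_topology}, 'f::euclidean_space) atlas"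
    and \<iota> :: "'n \<Rightarrow> 'm"
    and Jh :: "'n \<Rightarrow> 'f \<Rightarrow> 'f"
    and \<omega>h gh :: "'n \<Rightarrow> 'f \<Rightarrow> 'f \<Rightarrow> real"
    and n k :: nat
  assumes "almost_qsH n A Q \<omega>"
    and "unimodular_oproiu n A Q \<omega> D"
    and "DIM('f) = 2 * k"
    and "almost_pseudo_hermitian_submanifold A Q \<omega> B \<iota> Jh \<omega>h gh"
  shows "(type_X15 A \<omega> \<longrightarrow> almost_pseudo_kaehler_submanifold A Q \<omega> B \<iota> Jh \<omega>h gh) \<and>
    (qsH_torsion_free A \<omega> D \<or> type_X5 A \<omega> D \<longrightarrow>
      (\<forall>F. adapted_family A Q (adapted_connection A \<omega> D) B \<iota> Jh F \<longrightarrow>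
        (1 < k \<longrightarrow> (pseudo_kaehler_submanifold A Q \<omega> B \<iota> Jh \<omega>h gh \<longleftrightarrow> psi_vanishes A B \<iota> F)) \<and>
        (psi_vanishes A B \<iota> F \<longrightarrow> pseudo_kaehler_submanifold A Q \<omega> B \<iota> Jh \<omega>h gh)))"
proof -
  interpret connection_and_form A D \<omega>
    using assms(1,2) by unfold_locales (auto simp: almost_qsH_def unimodular_oproiu_def)
  interpret smooth_mapping A B \<iota>
    using assms(4) by unfold_locales
      (auto simp: almost_pseudo_hermitian_submanifold_def almost_complex_submanifold_def submanifold_def)
  have Q: "preserves_Q A Q D" using assms(2) by (simp add: unimodular_oproiu_def)
  have herm: "\<omega> p (J a p v) (J a p w) = \<omega> p v w"
    if "admissible_basis A Q U J" "a \<in> {1,2,3}" "p \<in> U" for U J a p v w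
    using assms(1) that unfolding almost_qsH_def by blast
  have Jh: "almost_complex B Jh"
    and inj: "\<And>x. inj (tmap A B \<iota> x)"
    and \<omega>h: "\<omega>h = pullback_form A B \<iota> \<omega>"
    using assms(4) by (auto simp: almost_pseudo_hermitian_submanifold_def
        almost_complex_submanifold_def submanifold_def)
  have Jh_lin: "linear (Jh x)" and Jh_sq: "Jh x (Jh x v) = - v" for x v
    using Jh by (auto simp: almost_complex_def smooth_End_def)
  have kaehler: "almost_pseudo_kaehler_submanifold A Q \<omega> B \<iota> Jh \<omega>h gh" if "closed_form A \<omega>"
    using closed_pullback[OF \<omega> that] assms(4) \<omega>h by (simp add: almost_pseudo_kaehler_submanifold_def)
  have part2: "(psi_vanishes A B \<iota> F \<longrightarrow> integrable_acs B Jh) \<and>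
      (1 < k \<longrightarrow> integrable_acs B Jh \<longrightarrow> psi_vanishes A B \<iota> F)"
    if tf: "qsH_torsion_free A \<omega> D \<or> torsion_free A D"
      and F: "adapted_family A Q (adapted_connection A \<omega> D) B \<iota> Jh F" for F
  proof -
    have N: "tmap A B \<iota> x (nijenhuis_at B Jh x u v)
        = psi J \<gamma> (\<iota> x) (tmap A B \<iota> x u) *\<^sub>R J 2 (\<iota> x) (tmap A B \<iota> x v)
        - psi J \<gamma> (\<iota> x) (tmap A B \<iota> x v) *\<^sub>R J 2 (\<iota> x) (tmap A B \<iota> x u)
        + psi J \<gamma> (\<iota> x) (tmap A B \<iota> x (Jh x u)) *\<^sub>R J 3 (\<iota> x) (tmap A B \<iota> x v)
        - psi J \<gamma> (\<iota> x) (tmap A B \<iota> x (Jh x v)) *\<^sub>R J 3 (\<iota> x) (tmap A B \<iota> x u)"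
      and adm: "admissible_at A Q U J (\<iota> x)"
      and J1: "J 1 (\<iota> x) (tmap A B \<iota> x v) = tmap A B \<iota> x (Jh x v)"
      if mem: "(V, U, J, \<gamma>) \<in> F" "x \<in> V" for V U J \<gamma> x u v
    proof -
      have ab: "adapted_basis A Q B \<iota> Jh V U J"
        and forms: "connection_forms A (adapted_connection A \<omega> D) U J \<gamma>"
        using F mem unfolding adapted_family_def by auto
      have V: "open V" "\<iota> ` V \<subseteq> U" and aU: "admissible_basis A Q U J"
        and rel: "\<And>q v. q \<in> V \<Longrightarrow> J 1 (\<iota> q) (tmap A B \<iota> q v) = tmap A B \<iota> q (Jh q v)"
        using ab unfolding adapted_basis_def by auto
      have px: "\<iota> x \<in> U" using V mem by auto
      show adm: "admissible_at A Q U J (\<iota> x)" using aU px by unfold_locales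
      interpret admissible_at A Q U J "\<iota> x" by (rule adm)
      have JhV: "smooth_End B V Jh"
        using Jh smooth_End_subset[of B UNIV Jh] by (auto simp: almost_complex_def)
      show "J 1 (\<iota> x) (tmap A B \<iota> x v) = tmap A B \<iota> x (Jh x v)" by (rule rel[OF mem(2)])
      show "tmap A B \<iota> x (nijenhuis_at B Jh x u v)
        = psi J \<gamma> (\<iota> x) (tmap A B \<iota> x u) *\<^sub>R J 2 (\<iota> x) (tmap A B \<iota> x v)
        - psi J \<gamma> (\<iota> x) (tmap A B \<iota> x v) *\<^sub>R J 2 (\<iota> x) (tmap A B \<iota> x u)
        + psi J \<gamma> (\<iota> x) (tmap A B \<iota> x (Jh x u)) *\<^sub>R J 3 (\<iota> x) (tmap A B \<iota> x v)
        - psi J \<gamma> (\<iota> x) (tmap A B \<iota> x (Jh x v)) *\<^sub>R J 3 (\<iota> x) (tmap A B \<iota> x u)"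
        using nijenhuis_at_related[OF smooth_J(1) open_U JhV V(1) mem(2) V(2) rel, of u v]
          nijenhuis_at_admissible[OF aU px Q herm[OF aU] forms tf, of "tmap A B \<iota> x u" "tmap A B \<iota> x v"]
        by (simp add: rel[OF mem(2)])
    qed
    have "integrable_acs B Jh" if psi: "psi_vanishes A B \<iota> F"
      unfolding N.integrable_acs_iff[OF Jh]
    proof (intro allI)
      fix x u v
      have "(\<Union>(V, U, J, \<gamma>)\<in>F. V) = UNIV" using F by (simp add: adapted_family_def)
      then have "x \<in> (\<Union>(V, U, J, \<gamma>)\<in>F. V)" by simp
      then obtain V U J \<gamma> where mem: "(V, U, J, \<gamma>) \<in> F" "x \<in> V" by auto
      have "psi J \<gamma> (\<iota> x) (tmap A B \<iota> x w) = 0" for w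
        using psi mem unfolding psi_vanishes_def by blast
      then have "tmap A B \<iota> x (nijenhuis_at B Jh x u v) = 0" by (simp add: N[OF mem])
      then show "nijenhuis_at B Jh x u v = 0"
        using inj linear_injective_0[OF linear_tmap] by blast
    qed
    moreover have "psi_vanishes A B \<iota> F" if k: "1 < k" and int: "integrable_acs B Jh"
      unfolding psi_vanishes_def
    proof clarify
      fix V U J \<gamma> x u assume mem: "(V, U, J, \<gamma>) \<in> F" "x \<in> V"
      interpret admissible_at A Q U J "\<iota> x" by (rule adm[OF mem])
      define f where "f w = psi J \<gamma> (\<iota> x) (tmap A B \<iota> x w)" for w
      have "f u *\<^sub>R v - f (Jh x u) *\<^sub>R Jh x v = f v *\<^sub>R u - f (Jh x v) *\<^sub>R Jh x u" for u v
      proof -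
        have "nijenhuis_at B Jh x u v = 0" using int N.integrable_acs_iff[OF Jh] by blast
        \<comment> \<open>\<open>J 2\<close> turns the coefficients \<open>J 2\<close> and
          \<open>J 3\<close> into minus the identity and \<open>J 1\<close>, which preserve the
          tangent space of the submanifold. The relation thus becomes the image under the injective
          differential of one between vectors at \<open>x\<close>.\<close>
        then have "J 2 (\<iota> x) (tmap A B \<iota> x (nijenhuis_at B Jh x u v)) = 0"
          by (simp add: linear_0[OF linear_tmap] linear_0[OF linear_J(2)])
        then have "tmap A B \<iota> x (f u *\<^sub>R v - f (Jh x u) *\<^sub>R Jh x v)
            = tmap A B \<iota> x (f v *\<^sub>R u - f (Jh x v) *\<^sub>R Jh x u)"
          unfolding N[OF mem] f_def[symmetric]
          by (simp add: J_simps J1[OF mem] linear_diff[OF linear_tmap] linear_cmul[OF linear_tmap] algebra_simps)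
        then show ?thesis using inj by (meson injD)
      qed
      from complex_proportionality_vanishes[where f = f, OF Jh_lin Jh_sq _ this] k assms(3)
      show "psi J \<gamma> (\<iota> x) (tmap A B \<iota> x u) = 0" by (simp add: f_def)
    qed
    ultimately show ?thesis by blast
  qed
  have closed: "closed_form A \<omega>" if "qsH_torsion_free A \<omega> D \<or> type_X5 A \<omega> D"
    using that qsH_torsion_free_closed by (auto simp: type_X5_def)
  show ?thesis
    using kaehler closed part2 unfolding type_X15_def type_X5_def pseudo_kaehler_submanifold_def by blast
qed

end
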